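(* Assume the setting described in the context. The admissible transvectants $(\alpha^{\mathbf k},\mathbf b_j)^{(s)}$, for $\mathbf k\in A$, $j=1,\dots,q$, and integers $0\le s\le\widehat\alpha\mathbf k$, $0\le s\le n_j-1$, form a formal vector space basis of $\mathcal E=\ker L_{N^*}$: they lie in $\mathcal E$, are linearly independent, and every element of $\mathcal E$ is a countable linear combination of them.
   Context: Let $N$ be a real nilpotent $n\times n$ matrix in upper Jordan form with Jordan blocks of sizes $n_1,\dots,n_q$ (block $N_k$ has ones on the superdiagonal, zeros elsewhere). Let $M$ and $H$ be block diagonal with corresponding blocks $M_k$ ($k\times k$, zero except subdiagonal entries $(M_k)_{i+1,i}=i(k-i)$, $i=1,\dots,k-1$) and $H_k=\mathrm{diag}(k-1,k-3,\dots,-(k-1))$; $(N,M,H)$ is an $\mathfrak{sl}_2$ triad. $^*$ is transpose. For a matrix $A$ and $f\in\mathbb R[[\mathbf x]]$, $\mathcal D_Af(\mathbf x)=f'(\mathbf x)A\mathbf x$; set $\mathcal X=\mathcal D_{N^*}$, $\mathcal Y=\mathcal D_{M^*}$, $\mathcal Z=\mathcal D_H$, $\mathcal J=\ker\mathcal X\subset\mathbb R[[\mathbf x]]$. A weight invariant is $f\in\mathcal J$ with $\mathcal Zf=\widehat ff$. For formal vector fields $\mathbf v$ on $\mathbb R^n$, $L_A\mathbf v=\mathbf v'(\mathbf x)A\mathbf x-A\mathbf v(\mathbf x)$, and $\mathcal E=\ker L_{N^*}$. Let $\alpha=(\alpha_1,\dots,\alpha_p)$ be a Hilbert basis of $\mathcal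 J$ (homogeneous weight invariants, weights $\widehat\alpha_i$, whose monomials $\alpha^{\mathbf k}$ span $\mathcal J$ by countable linear combinations; $\widehat\alpha\mathbf k=\sum\widehat\alpha_ik_i$) and $A\subset\mathbb N^p$ a standard preferred set (the $\alpha^{\mathbf k}$, $\mathbf k\in A$, pairwise distinct, linearly independent, spanning $\mathcal J$ by countable combinations; $A$ closed under componentwise-smaller vectors). Let $\mathbf b_j=\mathbf e_{r_j}$ be the standard basis vector of $\mathbb R^n$ whose index $r_j$ is the bottom row of the $j$-th Jordan block; it satisfies $N^*\mathbf b_j=0$ and $-H\mathbf b_j=(n_j-1)\mathbf b_j$; its weight is $\widehat{\mathbf b}_j=n_j-1$. For a weight invariant $f$, $\mathbf w=\mathbf b_j$, and $0\le s\le\min(\widehat f,\widehat{\mathbf w})$, the transvectant is the vector field $(f,\mathbf w)^{(s)}=\sum_{i=0}^s(-1)^i\binom si\frac{(\widehat f-i)!}{(\widehat f-s)!}\frac{(\widehat{\mathbf w}-s+i)!}{(\widehat{\mathbf w}-s)!}(\mathcal Y^if)\,\bigl((-M^* )^{s-i}\mathbf w\bigr)$. *)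

theory Defs
  imports Complex_Main
begin

text \<open>Variables are x_0,...,x_{n-1} (0-based). A monomial is an exponent function
  m :: nat => nat; a formal power series is its coefficient function. A series is
  "supported" if it only has nonzero coefficients on monomials in the n variables.\<close>

type_synonym mono = "nat \<Rightarrow> nat"
type_synonym fps_n = "mono \<Rightarrow> real"
type_synonym vfield = "nat \<Rightarrow> fps_n"
type_synonym mat = "nat \<Rightarrow> nat \<Rightarrow> real"

definition supp_fps :: "nat \<Rightarrow> fps_n \<Rightarrow> bool" where
  "supp_fps n f \<longleftrightarrow> (\<forall>m. f m \<noteq> 0 \<longrightarrow> (\<forall>i\<ge>n. m i = 0))"

definition supp_vf :: "nat \<Rightarrow> vfield \<Rightarrow> bool" where
  "supp_vf n v \<longleftrightarrow> (\<forall>r. supp_fps n (v r)) \<and> (\<forall>r\<ge>n. v r = (\<lambda>_. 0))"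

definition mulx :: "nat \<Rightarrow> fps_n \<Rightarrow> fps_n" where
  "mulx j f = (\<lambda>m. if 0 < m j then f (m(j := m j - 1)) else 0)"

definition pderiv_n :: "nat \<Rightarrow> fps_n \<Rightarrow> fps_n" where
  "pderiv_n i f = (\<lambda>m. real (m i + 1) * f (m(i := m i + 1)))"

definition fps_one :: fps_n where
  "fps_one = (\<lambda>m. if (\<forall>i. m i = 0) then 1 else 0)"

definition fps_mult :: "fps_n \<Rightarrow> fps_n \<Rightarrow> fps_n" where
  "fps_mult f g = (\<lambda>m. \<Sum>a\<in>{a. \<forall>i. a i \<le> m i}. f a * g (\<lambda>i. m i - a i))"

definition fps_pow :: "fps_n \<Rightarrow> nat \<Rightarrow> fps_n" where
  "fps_pow f k = ((fps_mult f) ^^ k) fps_one"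

definition fps_monom :: "fps_n list \<Rightarrow> nat list \<Rightarrow> fps_n" where
  "fps_monom \<alpha> k = foldr fps_mult (map2 fps_pow \<alpha> k) fps_one"

definition fps_homogeneous :: "nat \<Rightarrow> fps_n \<Rightarrow> bool" where
  "fps_homogeneous n f \<longleftrightarrow> (\<exists>d. \<forall>m. f m \<noteq> 0 \<longrightarrow> (\<Sum>i<n. m i) = d)"

text \<open>D_A f (x) = f'(x) A x = sum_{i,j} A_{ij} x_j d_i f\<close>
definition DA :: "nat \<Rightarrow> mat \<Rightarrow> fps_n \<Rightarrow> fps_n" where
  "DA n A f = (\<lambda>m. \<Sum>i<n. \<Sum>j<n. A i j * mulx j (pderiv_n i f) m)"

definition LA :: "nat \<Rightarrow> mat \<Rightarrow> vfield \<Rightarrow> vfield" where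
  "LA n A v = (\<lambda>r m. DA n A (v r) m - (\<Sum>c<n. A r c * v c m))"

definition transp :: "mat \<Rightarrow> mat" where
  "transp A = (\<lambda>r c. A c r)"

definition matvec :: "nat \<Rightarrow> mat \<Rightarrow> (nat \<Rightarrow> real) \<Rightarrow> (nat \<Rightarrow> real)" where
  "matvec n A v = (\<lambda>r. \<Sum>c<n. A r c * v c)"

text \<open>For block sizes ns and a 0-based row index r, locate r: Some (j, i, k) means
  r is local 0-based row i of block j, which has size k.\<close>
fun loc :: "nat list \<Rightarrow> nat \<Rightarrow> (nat \<times> nat \<times> nat) option" where
  "loc [] r = None"
| "loc (k # ks) r = (if r < k then Some (0, r, k)
      else map_option (\<lambda>(j, i, s). (Suc j, i, s)) (loc ks (r - k)))"

definition Nmat :: "nat list \<Rightarrow> mat" where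
  "Nmat ns = (\<lambda>r c. case (loc ns r, loc ns c) of
      (Some (j, i, k), Some (j', i', k')) \<Rightarrow> if j = j' \<and> i' = i + 1 then 1 else 0
    | _ \<Rightarrow> 0)"

text \<open>(M_k)_{a+1,a} = a(k-a) in 1-based indices; 0-based: row i'+1, column i', value (i'+1)(k-i'-1).\<close>
definition Mmat :: "nat list \<Rightarrow> mat" where
  "Mmat ns = (\<lambda>r c. case (loc ns r, loc ns c) of
      (Some (j, i, k), Some (j', i', k')) \<Rightarrow>
         if j = j' \<and> i = i' + 1 then real (i' + 1) * real (k - (i' + 1)) else 0
    | _ \<Rightarrow> 0)"

text \<open>H_k = diag(k-1, k-3, ..., -(k-1)); 0-based local index i gives k-1-2i.\<close>
definition Hmat :: "nat list \<Rightarrow> mat" where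
  "Hmat ns = (\<lambda>r c. case loc ns r of
      Some (j, i, k) \<Rightarrow> if r = c then real k - 1 - 2 * real i else 0
    | None \<Rightarrow> 0)"

definition dimn :: "nat list \<Rightarrow> nat" where
  "dimn ns = sum_list ns"

definition bottom_row :: "nat list \<Rightarrow> nat \<Rightarrow> nat" where
  "bottom_row ns j = sum_list (take j ns) + ns ! j - 1"

definition bvec :: "nat list \<Rightarrow> nat \<Rightarrow> (nat \<Rightarrow> real)" where
  "bvec ns j = (\<lambda>r. if r = bottom_row ns j then 1 else 0)"

definition Xop :: "nat list \<Rightarrow> fps_n \<Rightarrow> fps_n" where
  "Xop ns = DA (dimn ns) (transp (Nmat ns))"
definition Yop :: "nat list \<Rightarrow> fps_n \<Rightarrow> fps_n" where
  "Yop ns = DA (dimn ns) (transp (Mmat ns))"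
definition Zop :: "nat list \<Rightarrow> fps_n \<Rightarrow> fps_n" where
  "Zop ns = DA (dimn ns) (Hmat ns)"

definition Jset :: "nat list \<Rightarrow> fps_n set" where
  "Jset ns = {f. supp_fps (dimn ns) f \<and> Xop ns f = (\<lambda>_. 0)}"

definition Eset :: "nat list \<Rightarrow> vfield set" where
  "Eset ns = {v. supp_vf (dimn ns) v \<and> LA (dimn ns) (transp (Nmat ns)) v = (\<lambda>_ _. 0)}"

definition fsummable :: "('i \<Rightarrow> 'c \<Rightarrow> real) \<Rightarrow> 'i set \<Rightarrow> bool" where
  "fsummable g I \<longleftrightarrow> (\<forall>m. finite {i\<in>I. g i m \<noteq> 0})"

definition fsum :: "('i \<Rightarrow> 'c \<Rightarrow> real) \<Rightarrow> 'i set \<Rightarrow> 'c \<Rightarrow> real" where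
  "fsum g I = (\<lambda>m. \<Sum>i\<in>{i\<in>I. g i m \<noteq> 0}. g i m)"

definition formal_comb :: "('i \<Rightarrow> 'c \<Rightarrow> real) \<Rightarrow> 'i set \<Rightarrow> ('c \<Rightarrow> real) \<Rightarrow> bool" where
  "formal_comb g I x \<longleftrightarrow> (\<exists>c. fsummable (\<lambda>i m. c i * g i m) I \<and> x = fsum (\<lambda>i m. c i * g i m) I)"

definition formal_indep :: "('i \<Rightarrow> 'c \<Rightarrow> real) \<Rightarrow> 'i set \<Rightarrow> bool" where
  "formal_indep g I \<longleftrightarrow> (\<forall>c. fsummable (\<lambda>i m. c i * g i m) I \<and>
       fsum (\<lambda>i m. c i * g i m) I = (\<lambda>_. 0) \<longrightarrow> (\<forall>i\<in>I. c i = 0))"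

definition vf_coeffs :: "vfield \<Rightarrow> nat \<times> mono \<Rightarrow> real" where
  "vf_coeffs v = (\<lambda>(r, m). v r m)"

text \<open>(f, w)^{(s)} for weight invariant f of weight fw and constant vector w of weight ww\<close>
definition transvectant :: "nat list \<Rightarrow> fps_n \<Rightarrow> nat \<Rightarrow> (nat \<Rightarrow> real) \<Rightarrow> nat \<Rightarrow> nat \<Rightarrow> vfield" where
  "transvectant ns f fw w ww s = (\<lambda>r m. \<Sum>i\<le>s.
      (-1) ^ i * real (s choose i) * (fact (fw - i) / fact (fw - s))
        * (fact (ww - s + i) / fact (ww - s))
        * ((Yop ns ^^ i) f m)
        * ((matvec (dimn ns) (\<lambda>a b. - transp (Mmat ns) a b) ^^ (s - i)) w r))"

definition wt :: "nat list \<Rightarrow> nat list \<Rightarrow> nat" where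
  "wt wts k = sum_list (map2 (*) wts k)"

end

theory Submission
  imports Defs
begin

text \<open>Reading \<open>L v = 0\<close> row by row from the bottom of a Jordan block of size \<open>p\<close>, every component of
  \<open>v\<close> in the block is a power of \<open>X\<close> applied to the bottom component, and the only remaining condition
  is that \<open>X ^^ p\<close> kills the bottom component. So the kernel of \<open>L\<close> is the direct sum over the blocks
  of the kernels of \<open>X ^^ p\<close>. The bottom component of a transvectant with the bottom vector of its own
  block is a nonzero multiple of \<open>Y ^^ s\<close> applied to the monomial in the invariants, and it vanishes
  in the other blocks. It remains to see that the \<open>Y ^^ s\<close>-images with \<open>s < p\<close> and \<open>s\<close> at most the
  weight form a formal basis of the kernel of \<open>X ^^ p\<close>. This goes by induction on \<open>p\<close>, using that
  \<open>(X ^^ p) ((Y ^^ p) f)\<close> is a nonzero multiple of \<open>f\<close> for \<open>f\<close> in the kernel of \<open>X\<close> of weight at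
  least \<open>p\<close>, and that \<open>(X ^^ p) u\<close> in the kernel of \<open>X\<close> has no part of weight below \<open>p\<close>. Each
  coefficient of an image under \<open>X\<close> or \<open>Y\<close> depends on finitely many coefficients of the argument,
  so these operators commute with countable linear combinations.\<close>

section \<open>Countable linear combinations\<close>

text \<open>An infinite sum is 0 by convention, so \<open>fsum\<close> has a value even for families
  that are not summable. Pairing the value with summability gives a relation that can be transported
  through reindexing and operators.\<close>

definition has_fsum :: "('i \<Rightarrow> 'c \<Rightarrow> real) \<Rightarrow> 'i set \<Rightarrow> ('c \<Rightarrow> real) \<Rightarrow> bool" where
  "has_fsum g I x \<longleftrightarrow> fsummable g I \<and> x = fsum g I"

lemma has_fsum_pointwise:
  "has_fsum g I x \<longleftrightarrow> (\<forall>m. finite {i\<in>I. g i m \<noteq> 0} \<and> x m = (\<Sum>i\<in>{i\<in>I. g i m \<noteq> 0}. g i m))"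
  by (auto simp: has_fsum_def fsummable_def fsum_def)

text \<open>One finite index set can thus serve several coefficients at once, as needed when an
  operator combines them.\<close>

lemma has_fsum_finite_superset:
  assumes "has_fsum g I x" "finite F" "F \<subseteq> I" "{i\<in>I. g i m \<noteq> 0} \<subseteq> F"
  shows "x m = (\<Sum>i\<in>F. g i m)"
proof -
  have "x m = (\<Sum>i\<in>{i\<in>I. g i m \<noteq> 0}. g i m)"
    using assms(1) by (simp add: has_fsum_pointwise)
  also have "\<dots> = (\<Sum>i\<in>F. g i m)"
    by (rule sum.mono_neutral_left) (use assms in auto)
  finally show ?thesis .
qed

lemma has_fsum_cong:
  assumes "has_fsum g I x" "\<And>i. i \<in> I \<Longrightarrow> g i = h i"
  shows "has_fsum h I x"
proof -
  have "{i\<in>I. g i m \<noteq> 0} = {i\<in>I. h i m \<noteq> 0}" for m using assms(2) by auto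
  moreover have "(\<Sum>i\<in>{i\<in>I. h i m \<noteq> 0}. g i m) = (\<Sum>i\<in>{i\<in>I. h i m \<noteq> 0}. h i m)" for m
    by (rule sum.cong) (use assms(2) in auto)
  ultimately show ?thesis using assms(1) by (simp add: has_fsum_pointwise)
qed

lemma has_fsum_subset:
  assumes "has_fsum g I x" "J \<subseteq> I" "\<And>i. i \<in> I - J \<Longrightarrow> g i = (\<lambda>_. 0)"
  shows "has_fsum g J x"
proof -
  have "{i\<in>I. g i m \<noteq> 0} = {i\<in>J. g i m \<noteq> 0}" for m using assms(2,3) by (auto simp: fun_eq_iff)
  then show ?thesis using assms(1) by (simp add: has_fsum_pointwise)
qed

lemma has_fsum_superset:
  assumes "has_fsum g J x" "J \<subseteq> I" "\<And>i. i \<in> I - J \<Longrightarrow> g i = (\<lambda>_. 0)"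
  shows "has_fsum g I x"
proof -
  have "{i\<in>I. g i m \<noteq> 0} = {i\<in>J. g i m \<noteq> 0}" for m using assms(2,3) by (auto simp: fun_eq_iff)
  then show ?thesis using assms(1) by (simp add: has_fsum_pointwise)
qed

lemma has_fsum_reindex:
  assumes "inj_on h J"
  shows "has_fsum g (h ` J) x \<longleftrightarrow> has_fsum (\<lambda>j. g (h j)) J x"
proof -
  have eq: "{i\<in>h ` J. g i m \<noteq> 0} = h ` {j\<in>J. g (h j) m \<noteq> 0}" for m by auto
  have inj: "inj_on h {j\<in>J. g (h j) m \<noteq> 0}" for m
    using assms by (rule inj_on_subset) auto
  show ?thesis
    unfolding has_fsum_pointwise eq by (simp add: finite_image_iff[OF inj] sum.reindex[OF inj])
qed

lemma has_fsum_Un_disjoint: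
  assumes "has_fsum g I x" "has_fsum g J y" "I \<inter> J = {}"
  shows "has_fsum g (I \<union> J) (\<lambda>m. x m + y m)"
proof -
  have "{i\<in>I \<union> J. g i m \<noteq> 0} = {i\<in>I. g i m \<noteq> 0} \<union> {i\<in>J. g i m \<noteq> 0}" for m by auto
  moreover have "(\<Sum>i\<in>{i\<in>I. g i m \<noteq> 0} \<union> {i\<in>J. g i m \<noteq> 0}. g i m)
      = (\<Sum>i\<in>{i\<in>I. g i m \<noteq> 0}. g i m) + (\<Sum>i\<in>{i\<in>J. g i m \<noteq> 0}. g i m)" for m
    by (rule sum.union_disjoint) (use assms in \<open>auto simp: has_fsum_pointwise\<close>)
  ultimately show ?thesis using assms by (simp add: has_fsum_pointwise)
qed

lemma fsummable_rescale:
  assumes "fsummable (\<lambda>i m. c i * g i m) I" "\<And>i. i \<in> I \<Longrightarrow> c i = 0 \<Longrightarrow> d i = 0" "J \<subseteq> I"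
  shows "fsummable (\<lambda>i m. d i * g i m) J"
  unfolding fsummable_def
proof
  fix m
  have "{i \<in> J. d i * g i m \<noteq> 0} \<subseteq> {i \<in> I. c i * g i m \<noteq> 0}" using assms(2,3) by auto
  then show "finite {i \<in> J. d i * g i m \<noteq> 0}"
    using assms(1) unfolding fsummable_def by (meson finite_subset)
qed

lemma formal_comb_iff_has_fsum:
  "formal_comb g I x \<longleftrightarrow> (\<exists>c. has_fsum (\<lambda>i m. c i * g i m) I x)"
  by (simp add: formal_comb_def has_fsum_def)

lemma formal_indep_iff_has_fsum:
  "formal_indep g I \<longleftrightarrow> (\<forall>c. has_fsum (\<lambda>i m. c i * g i m) I (\<lambda>_. 0) \<longrightarrow> (\<forall>i\<in>I. c i = 0))"
  by (auto simp: formal_indep_def has_fsum_def)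

lemma formal_indepD:
  "formal_indep g I \<Longrightarrow> has_fsum (\<lambda>i m. c i * g i m) I (\<lambda>_. 0) \<Longrightarrow> i \<in> I \<Longrightarrow> c i = 0"
  unfolding formal_indep_iff_has_fsum by blast

lemma has_fsum_supp:
  assumes "has_fsum g I x" "\<And>i. i \<in> I \<Longrightarrow> supp_fps n (g i)"
  shows "supp_fps n x"
  unfolding supp_fps_def
proof (intro allI impI)
  fix m i assume "x m \<noteq> 0" "n \<le> i"
  then obtain j where "j \<in> I" "g j m \<noteq> 0"
    using assms(1) unfolding has_fsum_pointwise by (metis (mono_tags, lifting) mem_Collect_eq sum.neutral)
  then show "m i = 0" using assms(2) \<open>n \<le> i\<close> by (auto simp: supp_fps_def)
qed

lemma supp_fps_diff:
  assumes "supp_fps n f" "supp_fps n g"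
  shows "supp_fps n (\<lambda>m. f m - g m)"
  unfolding supp_fps_def
proof (intro allI impI)
  fix m i assume "f m - g m \<noteq> 0" "n \<le> i"
  then consider "f m \<noteq> 0" | "g m \<noteq> 0" by fastforce
  then show "m i = 0" using assms \<open>n \<le> i\<close> unfolding supp_fps_def by cases blast+
qed

section \<open>Row-finite linear operators\<close>

text \<open>These are the linear maps given by matrices with finitely many nonzero entries in each
  row, that is, the linear maps continuous for coefficientwise discrete convergence.\<close>

definition row_finite :: "(('c \<Rightarrow> real) \<Rightarrow> 'd \<Rightarrow> real) \<Rightarrow> bool" where
  "row_finite L \<longleftrightarrow>
     (\<forall>f g. L (\<lambda>m. f m + g m) = (\<lambda>m. L f m + L g m)) \<and>
     (\<forall>c f. L (\<lambda>m. c * f m) = (\<lambda>m. c * L f m)) \<and>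
     (\<forall>m. \<exists>S. finite S \<and> (\<forall>f. (\<forall>m'\<in>S. f m' = 0) \<longrightarrow> L f m = 0))"

lemma row_finite_add: "row_finite L \<Longrightarrow> L (\<lambda>m. f m + g m) = (\<lambda>m. L f m + L g m)"
  by (simp add: row_finite_def)

lemma row_finite_scale: "row_finite L \<Longrightarrow> L (\<lambda>m. c * f m) = (\<lambda>m. c * L f m)"
  by (simp add: row_finite_def)

lemma row_finite_zero: "row_finite L \<Longrightarrow> L (\<lambda>_. 0) = (\<lambda>_. 0)"
  using row_finite_scale[of L 0 "\<lambda>_. 0"] by simp

lemma row_finite_diff: "row_finite L \<Longrightarrow> L (\<lambda>m. f m - g m) = (\<lambda>m. L f m - L g m)"
  using row_finite_add[of L f "\<lambda>m. -1 * g m"] row_finite_scale[of L "-1" g] by simp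

lemma row_finite_sum:
  "row_finite L \<Longrightarrow> L (\<lambda>m. \<Sum>i\<in>F. g i m) = (\<lambda>m. \<Sum>i\<in>F. L (g i) m)"
proof (induction F rule: infinite_finite_induct)
  case (insert i F)
  then show ?case using row_finite_add[of L "g i" "\<lambda>m. \<Sum>i\<in>F. g i m"] by simp
qed (simp_all add: row_finite_zero)

text \<open>The coefficient of \<open>L x\<close> at \<open>m\<close> sees only finitely many
  coefficients of \<open>x\<close>, and only finitely many members of the family are nonzero there.
  This reduces the claim to linearity over the finite set \<open>F\<close> of these members.\<close>

lemma row_finite_has_fsum:
  assumes L: "row_finite L" and g: "has_fsum g I x"
  shows "has_fsum (\<lambda>i. L (g i)) I (L x)"
  unfolding has_fsum_pointwise
proof
  fix m
  obtain S where S: "finite S" "\<And>f. (\<forall>m'\<in>S. f m' = 0) \<Longrightarrow> L f m = 0"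
    using L unfolding row_finite_def by blast
  define F where "F = (\<Union>m'\<in>S. {i\<in>I. g i m' \<noteq> 0})"
  have F: "finite F" "F \<subseteq> I" using S(1) g by (auto simp: F_def has_fsum_pointwise)
  have sub: "{i\<in>I. L (g i) m \<noteq> 0} \<subseteq> F" 
  proof
    fix i assume i: "i \<in> {i\<in>I. L (g i) m \<noteq> 0}"
    then have "\<not> (\<forall>m'\<in>S. g i m' = 0)" using S(2)[of "g i"] by auto
    then show "i \<in> F" using i by (auto simp: F_def)
  qed
  have "x m' = (\<Sum>i\<in>F. g i m')" if "m' \<in> S" for m'
    using g F by (rule has_fsum_finite_superset) (use that in \<open>auto simp: F_def\<close>)
  then have "L (\<lambda>m'. x m' - (\<Sum>i\<in>F. g i m')) m = 0" by (intro S(2)) simp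
  then have "L x m = (\<Sum>i\<in>F. L (g i) m)"
    by (simp add: row_finite_diff[OF L] row_finite_sum[OF L])
  also have "\<dots> = (\<Sum>i\<in>{i\<in>I. L (g i) m \<noteq> 0}. L (g i) m)"
    by (rule sum.mono_neutral_right) (use F sub in auto)
  finally show "finite {i\<in>I. L (g i) m \<noteq> 0} \<and> L x m = (\<Sum>i\<in>{i\<in>I. L (g i) m \<noteq> 0}. L (g i) m)"
    using F(1) sub finite_subset by blast
qed

lemma row_finite_id: "row_finite (\<lambda>f. f)"
  unfolding row_finite_def by (auto intro!: exI[of _ "{_}"])

lemma row_finite_comp:
  assumes K: "row_finite K" and L: "row_finite L"
  shows "row_finite (\<lambda>f. K (L f))"
proof -
  have "\<exists>S. finite S \<and> (\<forall>f. (\<forall>m'\<in>S. f m' = 0) \<longrightarrow> K (L f) m = 0)" for m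
  proof -
    obtain S where S: "finite S" "\<And>f. (\<forall>m'\<in>S. f m' = 0) \<Longrightarrow> K f m = 0"
      using K unfolding row_finite_def by blast
    have "\<forall>m. \<exists>S. finite S \<and> (\<forall>f. (\<forall>m'\<in>S. f m' = 0) \<longrightarrow> L f m = 0)"
      using L unfolding row_finite_def by blast
    then obtain R where R: "\<And>m. finite (R m)" "\<And>m f. (\<forall>m'\<in>R m. f m' = 0) \<Longrightarrow> L f m = 0" by metis
    show ?thesis by (rule exI[of _ "\<Union>m'\<in>S. R m'"]) (auto intro!: S R)
  qed
  then show ?thesis unfolding row_finite_def
    by (simp add: row_finite_add[OF L] row_finite_scale[OF L] row_finite_add[OF K] row_finite_scale[OF K])
qed

lemma row_finite_funpow:
  fixes L :: "('c \<Rightarrow> real) \<Rightarrow> 'c \<Rightarrow> real"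
  shows "row_finite L \<Longrightarrow> row_finite (L ^^ p)"
proof (induction p)
  case 0
  have "L ^^ 0 = (\<lambda>f. f)" by (simp add: fun_eq_iff)
  then show ?case using row_finite_id by metis
next
  case (Suc p)
  then show ?case using row_finite_comp[of L "L ^^ p"] by (simp add: comp_def)
qed

lemma row_finite_weighted_sum:
  assumes "\<And>i. i \<in> F \<Longrightarrow> row_finite (L i)"
  shows "row_finite (\<lambda>f m. \<Sum>i\<in>F. a i * L i f m)"
  unfolding row_finite_def
proof (intro conjI allI)
  fix f g show "(\<lambda>m. \<Sum>i\<in>F. a i * L i (\<lambda>m. f m + g m) m)
      = (\<lambda>m. (\<Sum>i\<in>F. a i * L i f m) + (\<Sum>i\<in>F. a i * L i g m))"
    by (simp add: row_finite_add[OF assms] algebra_simps sum.distrib)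
next
  fix c f show "(\<lambda>m. \<Sum>i\<in>F. a i * L i (\<lambda>m. c * f m) m) = (\<lambda>m. c * (\<Sum>i\<in>F. a i * L i f m))"
    by (simp add: row_finite_scale[OF assms] algebra_simps sum_distrib_left)
next
  fix m
  have "\<forall>i\<in>F. \<exists>S. finite S \<and> (\<forall>f. (\<forall>m'\<in>S. f m' = 0) \<longrightarrow> L i f m = 0)"
    using assms unfolding row_finite_def by blast
  then obtain R where R: "\<And>i. i \<in> F \<Longrightarrow> finite (R i)"
    "\<And>i f. i \<in> F \<Longrightarrow> (\<forall>m'\<in>R i. f m' = 0) \<Longrightarrow> L i f m = 0" by metis
  show "\<exists>S. finite S \<and> (\<forall>f. (\<forall>m'\<in>S. f m' = 0) \<longrightarrow> (\<Sum>i\<in>F. a i * L i f m) = 0)"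
  proof (cases "finite F")
    case True
    show ?thesis
      by (rule exI[of _ "\<Union>i\<in>F. R i"]) (use True in \<open>auto intro!: sum.neutral R\<close>)
  \<comment> \<open>For infinite \<open>F\<close> the sum is 0 by convention, so the empty set of
    arguments suffices.\<close>
  qed (auto intro: exI[of _ "{}"])
qed

lemma row_finite_mulx: "row_finite (mulx j)"
  unfolding row_finite_def
proof (intro conjI allI)
  fix m show "\<exists>S. finite S \<and> (\<forall>f. (\<forall>m'\<in>S. f m' = 0) \<longrightarrow> mulx j f m = 0)"
    by (rule exI[of _ "{m(j := m j - 1)}"]) (simp add: mulx_def)
qed (auto simp: mulx_def)

lemma row_finite_pderiv_n: "row_finite (pderiv_n i)"
  unfolding row_finite_def
proof (intro conjI allI)
  fix m show "\<exists>S. finite S \<and> (\<forall>f. (\<forall>m'\<in>S. f m' = 0) \<longrightarrow> pderiv_n i f m = 0)"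
    by (rule exI[of _ "{m(i := m i + 1)}"]) (simp add: pderiv_n_def)
qed (auto simp: pderiv_n_def algebra_simps)

lemma DA_eq_sum_pairs:
  "DA n A f = (\<lambda>m. \<Sum>p\<in>{..<n} \<times> {..<n}. A (fst p) (snd p) * mulx (snd p) (pderiv_n (fst p) f) m)"
  by (simp add: DA_def sum.cartesian_product split_def)

lemma row_finite_DA: "row_finite (DA n A)"
  unfolding DA_eq_sum_pairs
  by (rule row_finite_weighted_sum) (rule row_finite_comp[OF row_finite_mulx row_finite_pderiv_n])

section \<open>Linear vector fields as derivations\<close>

text \<open>The Weyl algebra relation: the bracket of \<open>d_i\<close> with \<open>x_j\<close> is
  1 for \<open>i = j\<close> and 0 otherwise.\<close>

lemma pderiv_n_mulx:
  "pderiv_n i (mulx j f) = (\<lambda>m. mulx j (pderiv_n i f) m + (if i = j then f m else 0))"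
proof
  fix m :: mono
  have "m(j := m j) = m" by (rule fun_upd_triv)
  then show "pderiv_n i (mulx j f) m = mulx j (pderiv_n i f) m + (if i = j then f m else 0)"
    by (cases "i = j"; cases "m j")
       (auto simp: pderiv_n_def mulx_def fun_upd_twist algebra_simps)
qed

lemma pderiv_n_commute: "pderiv_n i (pderiv_n j f) = pderiv_n j (pderiv_n i f)"
  by (cases "i = j") (auto simp: pderiv_n_def fun_upd_twist)

lemma mulx_commute: "mulx i (mulx j f) = mulx j (mulx i f)"
  by (cases "i = j") (auto simp: mulx_def fun_upd_twist)

text \<open>Normal ordering: moving all variables to the left of all derivatives leaves a
  second-order part, symmetric in the two fields, and a first-order part. The latter belongs to the
  matrix product \<open>B A\<close>, in the opposite order.\<close>

lemma DA_DA:
  "DA n A (DA n B f) m =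
     (\<Sum>i<n. \<Sum>j<n. \<Sum>k<n. \<Sum>l<n. A i j * B k l * mulx j (mulx l (pderiv_n i (pderiv_n k f))) m)
     + DA n (\<lambda>k j. \<Sum>i<n. B k i * A i j) f m"
proof -
  have "mulx j (pderiv_n i (DA n B f)) m =
      (\<Sum>k<n. \<Sum>l<n. B k l * mulx j (mulx l (pderiv_n i (pderiv_n k f))) m)
      + (\<Sum>k<n. B k i * mulx j (pderiv_n k f) m)" if "i < n" for i j
  proof -
    have rf: "row_finite (\<lambda>f. mulx j (pderiv_n i f))"
      by (rule row_finite_comp[OF row_finite_mulx row_finite_pderiv_n])
    have "mulx j (pderiv_n i (DA n B f)) m
        = (\<Sum>k<n. \<Sum>l<n. B k l * mulx j (pderiv_n i (mulx l (pderiv_n k f))) m)"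
      unfolding DA_def by (simp add: row_finite_sum[OF rf] row_finite_scale[OF rf])
    also have "\<dots> = (\<Sum>k<n. \<Sum>l<n. B k l * mulx j (mulx l (pderiv_n i (pderiv_n k f))) m
        + (if i = l then B k l * mulx j (pderiv_n k f) m else 0))"
      by (intro sum.cong refl)
         (simp add: pderiv_n_mulx row_finite_add[OF row_finite_mulx] row_finite_zero[OF row_finite_mulx]
            distrib_left)
    also have "\<dots> = (\<Sum>k<n. \<Sum>l<n. B k l * mulx j (mulx l (pderiv_n i (pderiv_n k f))) m)
      + (\<Sum>k<n. B k i * mulx j (pderiv_n k f) m)"
      using that by (simp add: sum.distrib sum.delta')
    finally show ?thesis .
  qed
  then have "DA n A (DA n B f) m = (\<Sum>i<n. \<Sum>j<n. A i j *
      ((\<Sum>k<n. \<Sum>l<n. B k l * mulx j (mulx l (pderiv_n i (pderiv_n k f))) m)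
      + (\<Sum>k<n. B k i * mulx j (pderiv_n k f) m)))"
    unfolding DA_def[of n A] by simp
  also have "\<dots> = (\<Sum>i<n. \<Sum>j<n. \<Sum>k<n. \<Sum>l<n. A i j * B k l * mulx j (mulx l (pderiv_n i (pderiv_n k f))) m)
      + (\<Sum>i<n. \<Sum>j<n. \<Sum>k<n. A i j * B k i * mulx j (pderiv_n k f) m)"
    by (simp add: distrib_left sum.distrib sum_distrib_left mult.assoc)
  also have "(\<Sum>i<n. \<Sum>j<n. \<Sum>k<n. A i j * B k i * mulx j (pderiv_n k f) m)
      = (\<Sum>i<n. \<Sum>k<n. \<Sum>j<n. A i j * B k i * mulx j (pderiv_n k f) m)"
    by (intro sum.cong refl sum.swap)
  also have "\<dots> = (\<Sum>k<n. \<Sum>i<n. \<Sum>j<n. A i j * B k i * mulx j (pderiv_n k f) m)"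
    by (rule sum.swap)
  also have "\<dots> = (\<Sum>k<n. \<Sum>j<n. \<Sum>i<n. A i j * B k i * mulx j (pderiv_n k f) m)"
    by (intro sum.cong refl sum.swap)
  also have "\<dots> = DA n (\<lambda>k j. \<Sum>i<n. B k i * A i j) f m"
    by (simp add: DA_def sum_distrib_left sum_distrib_right mult_ac)
  finally show ?thesis .
qed

text \<open>The second-order parts of the two compositions cancel. The order of the matrices is
  reversed: the bracket of \<open>D_A\<close> and \<open>D_B\<close> is
  \<open>D_(BA - AB)\<close>.\<close>

lemma DA_commutator:
  "DA n A (DA n B f) m - DA n B (DA n A f) m
     = DA n (\<lambda>r c. (\<Sum>i<n. B r i * A i c) - (\<Sum>i<n. A r i * B i c)) f m"
proof -
  have "(\<Sum>i<n. \<Sum>j<n. \<Sum>k<n. \<Sum>l<n. A i j * B k l * mulx j (mulx l (pderiv_n i (pderiv_n k f))) m)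
      = (\<Sum>i<n. \<Sum>k<n. \<Sum>j<n. \<Sum>l<n. A i j * B k l * mulx j (mulx l (pderiv_n i (pderiv_n k f))) m)"
    by (intro sum.cong refl sum.swap)
  also have "\<dots> = (\<Sum>k<n. \<Sum>i<n. \<Sum>j<n. \<Sum>l<n. A i j * B k l * mulx j (mulx l (pderiv_n i (pderiv_n k f))) m)"
    by (rule sum.swap)
  also have "\<dots> = (\<Sum>k<n. \<Sum>i<n. \<Sum>l<n. \<Sum>j<n. A i j * B k l * mulx j (mulx l (pderiv_n i (pderiv_n k f))) m)"
    by (intro sum.cong refl sum.swap)
  also have "\<dots> = (\<Sum>k<n. \<Sum>l<n. \<Sum>i<n. \<Sum>j<n. B k l * A i j * mulx l (mulx j (pderiv_n k (pderiv_n i f))) m)"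
    (is "?l = ?r")
  proof -
    have "?r = (\<Sum>k<n. \<Sum>i<n. \<Sum>l<n. \<Sum>j<n. B k l * A i j * mulx l (mulx j (pderiv_n k (pderiv_n i f))) m)"
      by (intro sum.cong refl sum.swap)
    then show ?thesis
      by (simp only: mulx_commute pderiv_n_commute mult.commute)
  qed
  finally show ?thesis
    by (simp add: DA_DA) (simp add: DA_def sum_subtractf left_diff_distrib)
qed


lemma mulx_pderiv_n:
  "mulx j (pderiv_n i f) m
    = (if 0 < m j then real (Suc ((m(j := m j - 1)) i)) *
        f ((m(j := m j - 1))(i := Suc ((m(j := m j - 1)) i))) else 0)"
  by (simp add: mulx_def pderiv_n_def)

section \<open>Supports, products of series and the Leibniz rule\<close>

lemma supp_DA:
  assumes "supp_fps n f"
  shows "supp_fps n (DA n A f)"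
  unfolding supp_fps_def
proof (intro allI impI)
  fix m k assume "DA n A f m \<noteq> 0" and k: "n \<le> k"
  then obtain i j where ij: "i < n" "j < n" "mulx j (pderiv_n i f) m \<noteq> 0"
    unfolding DA_def by (metis (no_types, lifting) lessThan_iff mult_zero_right sum.neutral)
  then have "f ((m(j := m j - 1))(i := Suc ((m(j := m j - 1)) i))) \<noteq> 0"
    by (auto simp: mulx_pderiv_n split: if_splits)
  then have "((m(j := m j - 1))(i := Suc ((m(j := m j - 1)) i))) k = 0"
    using assms k unfolding supp_fps_def by blast
  then show "m k = 0" using ij k by (simp split: if_splits)
qed

lemma supp_funpow_DA: "supp_fps n f \<Longrightarrow> supp_fps n ((DA n A ^^ p) f)"
  by (induction p) (simp_all add: supp_DA)

text \<open>The sum in \<open>fps_mult\<close> runs over this set. A monomial of infinite support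
  has infinitely many divisors, which is why the support bound recurs in the lemmas on
  products.\<close>

lemma finite_below:
  fixes m :: mono
  assumes "\<And>i. n \<le> i \<Longrightarrow> m i = 0"
  shows "finite {a. \<forall>i. a i \<le> m i}"
proof (rule finite_subset)
  show "finite {a. \<forall>i. (i \<in> {..<n} \<longrightarrow> a i \<in> {..Max (m ` {..<n})}) \<and> (i \<notin> {..<n} \<longrightarrow> a i = 0)}"
    by (rule finite_set_of_finite_funs) auto
  show "{a. \<forall>i. a i \<le> m i} \<subseteq>
      {a. \<forall>i. (i \<in> {..<n} \<longrightarrow> a i \<in> {..Max (m ` {..<n})}) \<and> (i \<notin> {..<n} \<longrightarrow> a i = 0)}"
  proof (intro subsetI CollectI allI conjI impI)
    fix a i assume a: "a \<in> {a. \<forall>i. a i \<le> m i}"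
    {
      assume "i \<in> {..<n}"
      then have "m i \<le> Max (m ` {..<n})" by simp
      then show "a i \<in> {..Max (m ` {..<n})}" using a by (auto intro: order_trans)
    next
      assume "i \<notin> {..<n}"
      then show "a i = 0" using a assms by (metis (mono_tags, lifting) lessThan_iff le_zero_eq linorder_not_less mem_Collect_eq)
    }
  qed
qed

lemma supp_fps_mult:
  assumes "supp_fps n f" "supp_fps n g"
  shows "supp_fps n (fps_mult f g)"
  unfolding supp_fps_def
proof (intro allI impI)
  fix m i assume "fps_mult f g m \<noteq> 0" and i: "n \<le> i"
  then obtain a where a: "\<forall>i. a i \<le> m i" "f a * g (\<lambda>i. m i - a i) \<noteq> 0"
    unfolding fps_mult_def by (metis (mono_tags, lifting) mem_Collect_eq sum.neutral)
  then have "a i = 0" "m i - a i = 0" using assms i by (auto simp: supp_fps_def)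
  then show "m i = 0" by simp
qed

text \<open>Raising the exponent of the first factor at \<open>j\<close> matches the two sums; terms
  with \<open>a j = 0\<close> contribute nothing, since \<open>mulx j f\<close> vanishes
  there.\<close>

lemma mulx_fps_mult_left:
  assumes "\<And>i. n \<le> i \<Longrightarrow> m i = 0"
  shows "mulx j (fps_mult f g) m = fps_mult (mulx j f) g m"
proof (cases "m j")
  case 0
  then have "mulx j f a = 0" if "\<forall>i. a i \<le> m i" for a
    using that[rule_format, of j] by (simp add: mulx_def)
  then have "fps_mult (mulx j f) g m = 0" by (simp add: fps_mult_def)
  then show ?thesis using 0 by (simp add: mulx_def)
next
  case (Suc t)
  let ?m = "m(j := t)"
  have "mulx j (fps_mult f g) m = (\<Sum>a\<in>{a. \<forall>i. a i \<le> ?m i}. f a * g (\<lambda>i. ?m i - a i))"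
    using Suc by (simp add: mulx_def fps_mult_def)
  also have "\<dots> = (\<Sum>a\<in>{a. \<forall>i. a i \<le> m i} \<inter> {a. 0 < a j}. mulx j f a * g (\<lambda>i. m i - a i))"
  proof (rule sum.reindex_bij_witness[of _ "\<lambda>a. a(j := a j - 1)" "\<lambda>a. a(j := Suc (a j))"])
    fix a assume a: "a \<in> {a. \<forall>i. a i \<le> ?m i}"
    then have le: "a i \<le> ?m i" for i by blast
    have aj: "a j \<le> t" using le[of j] by simp
    moreover have "a i \<le> m i" if "i \<noteq> j" for i using le[of i] that by simp
    ultimately have "a(j := Suc (a j)) \<in> {a. \<forall>i. a i \<le> m i}" using Suc by simp
    then show "a(j := Suc (a j)) \<in> {a. \<forall>i. a i \<le> m i} \<inter> {a. 0 < a j}"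
      by (rule IntI) simp
    have "(\<lambda>i. m i - (a(j := Suc (a j))) i) = (\<lambda>i. ?m i - a i)" using Suc by auto
    then show "mulx j f (a(j := Suc (a j))) * g (\<lambda>i. m i - (a(j := Suc (a j))) i)
        = f a * g (\<lambda>i. ?m i - a i)"
      by (simp add: mulx_def)
  next
    fix a assume a: "a \<in> {a. \<forall>i. a i \<le> m i} \<inter> {a. 0 < a j}"
    then have "a j \<le> m j" by blast
    then have "a j \<le> Suc t" using Suc by simp
    then show "a(j := a j - 1) \<in> {a. \<forall>i. a i \<le> ?m i}" using a by auto
    show "(a(j := a j - 1))(j := Suc ((a(j := a j - 1)) j)) = a" using a by auto
  qed auto
  also have "\<dots> = (\<Sum>a\<in>{a. \<forall>i. a i \<le> m i}. mulx j f a * g (\<lambda>i. m i - a i))"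
    by (rule sum.mono_neutral_left) (use finite_below[OF assms] in \<open>auto simp: mulx_def\<close>)
  finally show ?thesis by (simp add: fps_mult_def)
qed

lemma mulx_fps_mult_right:
  assumes "\<And>i. n \<le> i \<Longrightarrow> m i = 0"
  shows "mulx j (fps_mult f g) m = fps_mult f (mulx j g) m"
proof (cases "m j")
  case 0
  then show ?thesis by (simp add: mulx_def fps_mult_def)
next
  case (Suc t)
  let ?m = "m(j := t)"
  have "mulx j (fps_mult f g) m = (\<Sum>a\<in>{a. \<forall>i. a i \<le> ?m i}. f a * g (\<lambda>i. ?m i - a i))"
    using Suc by (simp add: mulx_def fps_mult_def)
  also have "\<dots> = (\<Sum>a\<in>{a. \<forall>i. a i \<le> ?m i}. f a * mulx j g (\<lambda>i. m i - a i))"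
  proof (rule sum.cong[OF refl])
    fix a assume "a \<in> {a. \<forall>i. a i \<le> ?m i}"
    then have "a j \<le> t" by (auto dest: spec[of _ j])
    moreover have "(\<lambda>i. m i - a i)(j := m j - a j - 1) = (\<lambda>i. ?m i - a i)" using Suc by auto
    ultimately show "f a * g (\<lambda>i. ?m i - a i) = f a * mulx j g (\<lambda>i. m i - a i)"
      using Suc by (simp add: mulx_def)
  qed
  also have "\<dots> = (\<Sum>a\<in>{a. \<forall>i. a i \<le> m i}. f a * mulx j g (\<lambda>i. m i - a i))"
  proof (rule sum.mono_neutral_left)
    show "{a. \<forall>i. a i \<le> ?m i} \<subseteq> {a. \<forall>i. a i \<le> m i}"
    proof clarify
      fix a i assume a: "\<forall>i. a i \<le> ?m i"
      show "a i \<le> m i" using spec[OF a, of i] Suc by (cases "i = j") auto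
    qed
    show "\<forall>a\<in>{a. \<forall>i. a i \<le> m i} - {a. \<forall>i. a i \<le> ?m i}. f a * mulx j g (\<lambda>i. m i - a i) = 0"
      using Suc by (auto simp: mulx_def not_le split: if_splits)
  qed (rule finite_below[OF assms])
  finally show ?thesis by (simp add: fps_mult_def)
qed

text \<open>The factor \<open>m i + 1\<close> is split as \<open>a i + (m i + 1 - a i)\<close>. The
  first share differentiates \<open>f\<close> after the exponent of \<open>a\<close> at
  \<open>i\<close> is lowered, the second differentiates \<open>g\<close>. The boundary terms
  \<open>a i = 0\<close> and \<open>a i = m i + 1\<close> carry the factor 0.\<close>

lemma pderiv_n_fps_mult:
  assumes m: "\<And>i. n \<le> i \<Longrightarrow> m i = 0" and "i < n"
  shows "pderiv_n i (fps_mult f g) m = fps_mult (pderiv_n i f) g m + fps_mult f (pderiv_n i g) m"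
proof -
  let ?m = "m(i := Suc (m i))"
  let ?B = "\<lambda>m. {a. \<forall>i. a i \<le> m i}"
  have fin: "finite (?B ?m)"
    by (rule finite_below[of n]) (use assms in auto)
  have sub: "?B m \<subseteq> ?B ?m" by (auto intro: le_SucI)
  have "pderiv_n i (fps_mult f g) m
      = (\<Sum>a\<in>?B ?m. real (Suc (m i)) * (f a * g (\<lambda>l. ?m l - a l)))"
    by (simp add: pderiv_n_def fps_mult_def sum_distrib_left)
  also have "\<dots> = (\<Sum>a\<in>?B ?m. real (a i) * (f a * g (\<lambda>l. ?m l - a l))
      + real (Suc (m i) - a i) * (f a * g (\<lambda>l. ?m l - a l)))"
  proof (rule sum.cong[OF refl])
    fix a assume "a \<in> ?B ?m"
    then have "a i \<le> Suc (m i)" by (auto dest: spec[of _ i])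
    then have "real (Suc (m i)) = real (a i) + real (Suc (m i) - a i)" by simp
    then show "real (Suc (m i)) * (f a * g (\<lambda>l. ?m l - a l))
      = real (a i) * (f a * g (\<lambda>l. ?m l - a l)) + real (Suc (m i) - a i) * (f a * g (\<lambda>l. ?m l - a l))"
      by (simp only: distrib_right)
  qed
  also have "\<dots> = (\<Sum>a\<in>?B ?m. real (a i) * (f a * g (\<lambda>l. ?m l - a l)))
      + (\<Sum>a\<in>?B ?m. real (Suc (m i) - a i) * (f a * g (\<lambda>l. ?m l - a l)))"
    by (rule sum.distrib)
  also have "(\<Sum>a\<in>?B ?m. real (a i) * (f a * g (\<lambda>l. ?m l - a l)))
      = (\<Sum>a\<in>?B ?m \<inter> {a. 0 < a i}. real (a i) * (f a * g (\<lambda>l. ?m l - a l)))"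
    by (rule sum.mono_neutral_right) (use fin in auto)
  also have "\<dots> = (\<Sum>a\<in>?B m. pderiv_n i f a * g (\<lambda>l. m l - a l))"
  proof (rule sum.reindex_bij_witness[of _ "\<lambda>a. a(i := Suc (a i))" "\<lambda>a. a(i := a i - 1)"])
    fix a assume a: "a \<in> ?B ?m \<inter> {a. 0 < a i}"
    show "(a(i := a i - 1))(i := Suc ((a(i := a i - 1)) i)) = a" using a by auto
    have le: "a l \<le> ?m l" for l using a by blast
    show "a(i := a i - 1) \<in> ?B m"
    proof clarify
      fix l show "(a(i := a i - 1)) l \<le> m l" using le[of l] by (auto split: if_splits)
    qed
    have "(\<lambda>l. m l - (a(i := a i - 1)) l) = (\<lambda>l. ?m l - a l)" using a by auto
    then show "pderiv_n i f (a(i := a i - 1)) * g (\<lambda>l. m l - (a(i := a i - 1)) l)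
      = real (a i) * (f a * g (\<lambda>l. ?m l - a l))"
      using a by (simp add: pderiv_n_def)
  next
    fix a assume a: "a \<in> ?B m"
    then show "a(i := Suc (a i)) \<in> ?B ?m \<inter> {a. 0 < a i}" by auto
  qed auto
  also have "(\<Sum>a\<in>?B ?m. real (Suc (m i) - a i) * (f a * g (\<lambda>l. ?m l - a l)))
      = (\<Sum>a\<in>?B m. real (Suc (m i) - a i) * (f a * g (\<lambda>l. ?m l - a l)))"
  proof (rule sum.mono_neutral_right[OF fin sub], rule ballI)
    fix a assume "a \<in> ?B ?m - ?B m"
    then obtain l where a: "a l \<le> ?m l" and l: "\<not> a l \<le> m l" by blast
    then have "l = i" by (auto split: if_splits)
    then have "Suc (m i) - a i = 0" using l by simp
    then show "real (Suc (m i) - a i) * (f a * g (\<lambda>l. ?m l - a l)) = 0" by simp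
  qed
  also have "\<dots> = (\<Sum>a\<in>?B m. f a * pderiv_n i g (\<lambda>l. m l - a l))"
  proof (rule sum.cong[OF refl])
    fix a assume "a \<in> ?B m"
    then have "a i \<le> m i" by blast
    then have "Suc (m i) - a i = Suc (m i - a i)"
      and "(\<lambda>l. ?m l - a l) = (\<lambda>l. m l - a l)(i := Suc (m i - a i))"
      by (auto simp: fun_eq_iff Suc_diff_le)
    then show "real (Suc (m i) - a i) * (f a * g (\<lambda>l. ?m l - a l)) = f a * pderiv_n i g (\<lambda>l. m l - a l)"
      by (simp add: pderiv_n_def)
  qed
  finally show ?thesis by (simp add: fps_mult_def)
qed

lemma DA_fps_mult:
  assumes f: "supp_fps n f" and g: "supp_fps n g"
  shows "DA n A (fps_mult f g) = (\<lambda>m. fps_mult (DA n A f) g m + fps_mult f (DA n A g) m)"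
proof
  fix m
  show "DA n A (fps_mult f g) m = fps_mult (DA n A f) g m + fps_mult f (DA n A g) m"
  proof (cases "\<forall>i\<ge>n. m i = 0")
    \<comment> \<open>Here all three series have coefficient 0 by their supports, so the product
      sums are not touched.\<close>
    case False
    then have z: "supp_fps n h \<Longrightarrow> h m = 0" for h unfolding supp_fps_def by blast
    have "DA n A (fps_mult f g) m = 0" "fps_mult (DA n A f) g m = 0" "fps_mult f (DA n A g) m = 0"
      by (rule z, intro supp_DA supp_fps_mult f g)+
    then show ?thesis by simp
  next
    case True
    then have m: "\<And>i. n \<le> i \<Longrightarrow> m i = 0" by blast
    have leibniz: "mulx j (pderiv_n i (fps_mult f g)) m
        = fps_mult (mulx j (pderiv_n i f)) g m + fps_mult f (mulx j (pderiv_n i g)) m"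
      if "i < n" "j < n" for i j
    proof -
      have "pderiv_n i (fps_mult f g) (m(j := m j - 1)) =
         fps_mult (pderiv_n i f) g (m(j := m j - 1)) + fps_mult f (pderiv_n i g) (m(j := m j - 1))"
        by (rule pderiv_n_fps_mult) (use m that in auto)
      then have "mulx j (pderiv_n i (fps_mult f g)) m =
          mulx j (fps_mult (pderiv_n i f) g) m + mulx j (fps_mult f (pderiv_n i g)) m"
        by (simp add: mulx_def)
      then show ?thesis
        by (simp add: mulx_fps_mult_left[OF m, where j = j and f = "pderiv_n i f"]
          mulx_fps_mult_right[OF m, where j = j and g = "pderiv_n i g"])
    qed
    have "fps_mult (DA n A f) g m = (\<Sum>i<n. \<Sum>j<n. A i j * fps_mult (mulx j (pderiv_n i f)) g m)"
      unfolding DA_def fps_mult_def sum_distrib_right sum_distrib_left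
      by (subst sum.swap, intro sum.cong refl, subst sum.swap) (simp add: mult_ac)
    moreover have "fps_mult f (DA n A g) m = (\<Sum>i<n. \<Sum>j<n. A i j * fps_mult f (mulx j (pderiv_n i g)) m)"
      unfolding DA_def fps_mult_def sum_distrib_right sum_distrib_left
      by (subst sum.swap, intro sum.cong refl, subst sum.swap) (simp add: mult_ac)
    moreover have "DA n A (fps_mult f g) m = (\<Sum>i<n. \<Sum>j<n. A i j * fps_mult (mulx j (pderiv_n i f)) g m)
        + (\<Sum>i<n. \<Sum>j<n. A i j * fps_mult f (mulx j (pderiv_n i g)) m)"
      unfolding DA_def by (simp add: leibniz distrib_left sum.distrib)
    ultimately show ?thesis by simp
  qed
qed

section \<open>Weights of monomials\<close>

text \<open>For \<open>h\<close> the diagonal of \<open>H\<close> this is the eigenvalue of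
  \<open>D_H\<close> on the monomial; for \<open>h\<close> constantly 1 it is the degree. Both
  gradings are used below.\<close>

definition mweight :: "nat \<Rightarrow> (nat \<Rightarrow> real) \<Rightarrow> mono \<Rightarrow> real" where
  "mweight n h m = (\<Sum>i<n. h i * real (m i))"

definition has_weight :: "nat \<Rightarrow> (nat \<Rightarrow> real) \<Rightarrow> real \<Rightarrow> fps_n \<Rightarrow> bool" where
  "has_weight n h c f \<longleftrightarrow> (\<forall>m. f m \<noteq> 0 \<longrightarrow> mweight n h m = c)"

definition weight_part :: "nat \<Rightarrow> (nat \<Rightarrow> real) \<Rightarrow> real \<Rightarrow> fps_n \<Rightarrow> fps_n" where
  "weight_part n h c f = (\<lambda>m. if mweight n h m = c then f m else 0)"

lemma has_weight_weight_part: "has_weight n h c (weight_part n h c f)"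
  by (simp add: has_weight_def weight_part_def)

lemma weight_part_has_weight: "has_weight n h c f \<Longrightarrow> weight_part n h c f = f"
  by (auto simp: has_weight_def weight_part_def fun_eq_iff)

lemma weight_part_other_weight:
  "has_weight n h c f \<Longrightarrow> c \<noteq> d \<Longrightarrow> weight_part n h d f = (\<lambda>_. 0)"
  by (auto simp: has_weight_def weight_part_def fun_eq_iff)

lemma row_finite_weight_part: "row_finite (weight_part n h c)"
  unfolding row_finite_def weight_part_def by (auto intro: exI[of _ "{_}"])

lemma mweight_fun_upd: "i < n \<Longrightarrow> mweight n h (m(i := a)) = mweight n h m + h i * (real a - real (m i))"
proof -
  assume i: "i < n"
  have "mweight n h (m(i := a)) = (\<Sum>l<n. h l * real (m l) + (if l = i then h i * (real a - real (m i)) else 0))"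
    unfolding mweight_def by (intro sum.cong refl) (simp add: algebra_simps)
  then show ?thesis using i by (simp add: mweight_def sum.distrib)
qed

text \<open>The field \<open>x_j d_i\<close> trades a factor \<open>x_i\<close> for
  \<open>x_j\<close> and so changes the weight by \<open>h j - h i\<close>, which is
  \<open>d\<close> for every entry that occurs.\<close>

lemma DA_weight_part:
  assumes "\<And>i j. i < n \<Longrightarrow> j < n \<Longrightarrow> A i j \<noteq> 0 \<Longrightarrow> h j = h i + d"
  shows "DA n A (weight_part n h c f) = weight_part n h (c + d) (DA n A f)"
proof
  fix m
  have "A i j * mulx j (pderiv_n i (weight_part n h c f)) m
      = (if mweight n h m = c + d then A i j * mulx j (pderiv_n i f) m else 0)"
    if ij: "i < n" "j < n" for i j
  proof (cases "A i j \<noteq> 0 \<and> 0 < m j")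
    case True
    then have "mweight n h ((m(j := m j - 1))(i := Suc ((m(j := m j - 1)) i))) = mweight n h m - d"
      using assms[OF ij] by (simp add: mweight_fun_upd ij algebra_simps of_nat_diff)
    then show ?thesis by (auto simp: mulx_pderiv_n weight_part_def)
  qed (auto simp: mulx_pderiv_n)
  then show "DA n A (weight_part n h c f) m = weight_part n h (c + d) (DA n A f) m"
    unfolding DA_def weight_part_def[of n h "c + d"] by simp
qed

lemma has_weight_DA:
  assumes "\<And>i j. i < n \<Longrightarrow> j < n \<Longrightarrow> A i j \<noteq> 0 \<Longrightarrow> h j = h i + d" "has_weight n h c f"
  shows "has_weight n h (c + d) (DA n A f)"
proof -
  have "DA n A (weight_part n h c f) = weight_part n h (c + d) (DA n A f)"
    using assms(1) by (rule DA_weight_part)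
  then show ?thesis using weight_part_has_weight[OF assms(2)] has_weight_weight_part by metis
qed

lemma DA_diagonal:
  "DA n (\<lambda>r c. if r = c then h r else 0) f = (\<lambda>m. mweight n h m * f m)"
proof
  fix m
  have "mulx i (pderiv_n i f) m = real (m i) * f m" for i
    by (cases "m i") (simp_all add: mulx_pderiv_n fun_upd_idem)
  moreover have "DA n (\<lambda>r c. if r = c then h r else 0) f m = (\<Sum>i<n. h i * mulx i (pderiv_n i f) m)"
    unfolding DA_def by (intro sum.cong refl) (simp add: if_distrib[of "\<lambda>a. a * _"] cong: if_cong)
  ultimately show "DA n (\<lambda>r c. if r = c then h r else 0) f m = mweight n h m * f m"
    by (simp add: mweight_def sum_distrib_right mult.assoc)
qed

lemma has_weight_fps_mult:
  assumes "has_weight n h c f" "has_weight n h d g"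
  shows "has_weight n h (c + d) (fps_mult f g)"
  unfolding has_weight_def
proof (intro allI impI)
  fix m assume "fps_mult f g m \<noteq> 0"
  then obtain a where a: "\<forall>i. a i \<le> m i" "f a * g (\<lambda>i. m i - a i) \<noteq> 0"
    unfolding fps_mult_def by (metis (mono_tags, lifting) mem_Collect_eq sum.neutral)
  then have "mweight n h a = c" "mweight n h (\<lambda>i. m i - a i) = d"
    using assms by (auto simp: has_weight_def)
  moreover have "mweight n h m = mweight n h a + mweight n h (\<lambda>i. m i - a i)"
    unfolding mweight_def sum.distrib[symmetric]
    by (intro sum.cong refl) (use a(1) in \<open>simp add: of_nat_diff algebra_simps\<close>)
  ultimately show "mweight n h m = c + d" by simp
qed


section \<open>The triad of a Jordan form\<close>

text \<open>Replaces the recursion by arithmetic: block \<open>j\<close> starts at the sum of the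
  earlier sizes.\<close>

lemma loc_eq_Some_iff:
  "loc ns r = Some (j, i, k) \<longleftrightarrow>
     j < length ns \<and> k = ns ! j \<and> i < k \<and> r = sum_list (take j ns) + i"
proof (induction ns arbitrary: r j)
  case (Cons a ns)
  show ?case
  proof (cases j)
    case 0
    then show ?thesis by (auto split: prod.splits)
  next
    case (Suc j')
    have "loc (a # ns) r = Some (j, i, k) \<longleftrightarrow> a \<le> r \<and> loc ns (r - a) = Some (j', i, k)"
      using Suc by auto
    then show ?thesis using Cons[of "r - a" j'] Suc by auto
  qed
qed simp

lemma loc_eq_None_iff: "loc ns r = None \<longleftrightarrow> dimn ns \<le> r"
  unfolding dimn_def by (induction ns arbitrary: r) (auto simp: le_diff_conv2)

lemma loc_less_dimn: "loc ns r = Some p \<Longrightarrow> r < dimn ns"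
  using loc_eq_None_iff[of ns r] by (metis not_le option.distinct(1))

lemma loc_Suc: "loc ns r = Some (j, i, k) \<Longrightarrow> Suc i < k \<Longrightarrow> loc ns (Suc r) = Some (j, Suc i, k)"
  by (simp add: loc_eq_Some_iff)

lemma loc_pred: "loc ns r = Some (j, Suc i, k) \<Longrightarrow> loc ns (r - 1) = Some (j, i, k)"
  by (simp add: loc_eq_Some_iff)

lemma loc_row_below:
  assumes "loc ns r = Some (j, i, k)"
  shows "(\<exists>k'. loc ns c = Some (j, Suc i, k')) \<longleftrightarrow> c = Suc r \<and> Suc i < k"
  using assms by (auto simp: loc_eq_Some_iff)

lemma loc_row_above:
  assumes "loc ns r = Some (j, i, k)"
  shows "(\<exists>l k'. i = Suc l \<and> loc ns c = Some (j, l, k')) \<longleftrightarrow> Suc c = r \<and> 0 < i"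
proof
  assume "Suc c = r \<and> 0 < i"
  then show "\<exists>l k'. i = Suc l \<and> loc ns c = Some (j, l, k')"
    using loc_pred[of ns r j "i - 1" k] assms by (intro exI[of _ "i - 1"] exI[of _ k]) auto
qed (use assms in \<open>auto simp: loc_eq_Some_iff\<close>)

lemma Nmat_row:
  assumes "loc ns r = Some (j, i, k)"
  shows "Nmat ns r c = (if c = Suc r \<and> Suc i < k then 1 else 0)"
  unfolding loc_row_below[OF assms, symmetric]
  by (cases "loc ns c") (auto simp: Nmat_def assms)

lemma Nmat_col:
  assumes "loc ns c = Some (j, i, k)"
  shows "Nmat ns r c = (if Suc r = c \<and> 0 < i then 1 else 0)"
  unfolding loc_row_above[OF assms, symmetric]
  by (cases "loc ns r") (auto simp: Nmat_def assms)

lemma Mmat_col: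
  assumes "loc ns c = Some (j, i, k)"
  shows "Mmat ns r c = (if r = Suc c \<and> Suc i < k then real (Suc i) * real (k - Suc i) else 0)"
proof (cases "r = Suc c \<and> Suc i < k")
  case True
  then show ?thesis using assms loc_Suc[OF assms] by (simp add: Mmat_def)
next
  case False
  then have "\<forall>k'. loc ns r \<noteq> Some (j, Suc i, k')" using loc_row_below[OF assms] by blast
  then show ?thesis using False assms by (cases "loc ns r") (auto simp: Mmat_def)
qed

abbreviation triad_weight :: "nat list \<Rightarrow> nat \<Rightarrow> real" where
  "triad_weight ns \<equiv> \<lambda>r. Hmat ns r r"

lemma Hmat_diagonal: "Hmat ns = (\<lambda>r c. if r = c then triad_weight ns r else 0)"
  by (auto simp: Hmat_def fun_eq_iff split: option.splits)

lemma triad_weight_eq: "loc ns r = Some (j, i, k) \<Longrightarrow> triad_weight ns r = real k - 1 - 2 * real i"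
  by (simp add: Hmat_def)

text \<open>Transposition reverses products, so this is the transpose of \<open>NM - MN = H\<close>.
  In local row \<open>i\<close> of a block of size \<open>k\<close> the diagonal entry is
  \<open>(i+1)(k-i-1) - i(k-i) = k-1-2i\<close>.\<close>

lemma triad_matrix_commutator:
  assumes "r < dimn ns" "c < dimn ns"
  shows "(\<Sum>x<dimn ns. transp (Mmat ns) r x * transp (Nmat ns) x c)
       - (\<Sum>x<dimn ns. transp (Nmat ns) r x * transp (Mmat ns) x c) = Hmat ns r c"
proof -
  obtain j i k where r: "loc ns r = Some (j, i, k)"
    using assms(1) loc_eq_None_iff[of ns r] by (metis not_le option.exhaust prod_cases3)
  have ik: "i < k" using r by (simp add: loc_eq_Some_iff)
  have "(\<Sum>x<dimn ns. transp (Mmat ns) r x * transp (Nmat ns) x c)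
      = (if c = r then real (Suc i) * real (k - Suc i) else 0)"
  proof (cases "Suc i < k")
    case True
    note Sr = loc_Suc[OF r True]
    have "(\<Sum>x<dimn ns. transp (Mmat ns) r x * transp (Nmat ns) x c)
        = (\<Sum>x<dimn ns. if x = Suc r then (if c = r then real (Suc i) * real (k - Suc i) else 0) else 0)"
      by (intro sum.cong refl) (use True Sr in \<open>auto simp: transp_def Mmat_col[OF r] Nmat_col[OF Sr]\<close>)
    then show ?thesis using loc_less_dimn[OF Sr] by simp
  next
    case False
    \<comment> \<open>In the last row of a block the common formula gives 0, as it must since no row
      follows.\<close>
    then have "k - Suc i = 0" by simp
    then show ?thesis using False by (simp add: transp_def Mmat_col[OF r])
  qed
  moreover have "(\<Sum>x<dimn ns. transp (Nmat ns) r x * transp (Mmat ns) x c)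
      = (if c = r then real i * real (k - i) else 0)"
  proof (cases i)
    case 0
    then show ?thesis by (simp add: transp_def Nmat_col[OF r])
  next
    case (Suc l)
    obtain r' where r': "r = Suc r'" using r Suc by (auto simp: loc_eq_Some_iff)
    have pr: "loc ns r' = Some (j, l, k)" using loc_pred[of ns r j l k] r Suc r' by simp
    have "(\<Sum>x<dimn ns. transp (Nmat ns) r x * transp (Mmat ns) x c)
        = (\<Sum>x<dimn ns. if x = r' then (if c = r then real i * real (k - i) else 0) else 0)"
      by (intro sum.cong refl)
         (use Suc ik r' in \<open>auto simp: transp_def Nmat_col[OF r[unfolded r']] Mmat_col[OF pr]\<close>)
    then show ?thesis using loc_less_dimn[OF pr] by simp
  qed
  moreover have "Hmat ns r c = (if c = r then real k - 1 - 2 * real i else 0)"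
    using r by (simp add: Hmat_def)
  ultimately show ?thesis using ik by (auto simp: of_nat_diff algebra_simps)
qed

section \<open>The triad acting on power series\<close>

context
  fixes ns :: "nat list"
begin

abbreviation "X \<equiv> Xop ns"
abbreviation "Y \<equiv> Yop ns"
abbreviation "supported \<equiv> supp_fps (dimn ns)"
abbreviation "weighted \<equiv> has_weight (dimn ns) (triad_weight ns)"
abbreviation "part \<equiv> weight_part (dimn ns) (triad_weight ns)"

lemma row_finite_Xop: "row_finite X" and row_finite_Yop: "row_finite Y"
  by (simp_all add: Xop_def Yop_def row_finite_DA)

lemmas row_finite_Xop_funpow = row_finite_funpow[OF row_finite_Xop]
lemmas row_finite_Yop_funpow = row_finite_funpow[OF row_finite_Yop]

lemma Zop_eq: "Zop ns f = (\<lambda>m. mweight (dimn ns) (triad_weight ns) m * f m)"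
  using DA_diagonal[of "dimn ns" "triad_weight ns" f] Hmat_diagonal[of ns] by (simp add: Zop_def)

text \<open>The relation \<open>XY - YX = Z\<close>. The order reversal in
  \<open>DA_commutator\<close> meets the order of the transposes in
  \<open>triad_matrix_commutator\<close>, so the sign is plus.\<close>

lemma Xop_Yop: "X (Y f) m = Y (X f) m + mweight (dimn ns) (triad_weight ns) m * f m"
proof -
  have "X (Y f) m - Y (X f) m = DA (dimn ns) (Hmat ns) f m"
    unfolding Xop_def Yop_def DA_commutator unfolding DA_def
    by (intro sum.cong refl) (simp only: triad_matrix_commutator lessThan_iff)
  then show ?thesis by (simp add: Zop_eq[unfolded Zop_def])
qed

text \<open>The entries of the transposed \<open>N\<close> lie just below the diagonal, and
  \<open>H\<close> drops by 2 per row inside a block. Hence \<open>X\<close> raises weights by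
  2.\<close>

lemma transp_Nmat_weight:
  assumes "transp (Nmat ns) i j \<noteq> 0"
  shows "triad_weight ns j = triad_weight ns i + 2"
proof -
  obtain b l k where j: "loc ns j = Some (b, l, k)"
    using assms by (auto simp: transp_def Nmat_def split: option.splits)
  then have "i = Suc j" "Suc l < k" using assms Nmat_row[OF j] by (auto simp: transp_def split: if_splits)
  then show ?thesis using triad_weight_eq[OF j] triad_weight_eq[OF loc_Suc[OF j]] by simp
qed

text \<open>Written with \<open>+ -2\<close> to match the shift \<open>d\<close> of
  \<open>has_weight_DA\<close>; it makes \<open>Y\<close> lower weights by 2.\<close>

lemma transp_Mmat_weight:
  assumes "transp (Mmat ns) i j \<noteq> 0"
  shows "triad_weight ns j = triad_weight ns i + -2"
proof -
  obtain b l k where i: "loc ns i = Some (b, l, k)"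
    using assms by (auto simp: transp_def Mmat_def split: option.splits)
  then have "j = Suc i" "Suc l < k" using assms Mmat_col[OF i] by (auto simp: transp_def split: if_splits)
  then show ?thesis using triad_weight_eq[OF i] triad_weight_eq[OF loc_Suc[OF i]] by simp
qed

lemma Xop_part: "X (part c f) = part (c + 2) (X f)"
  unfolding Xop_def by (rule DA_weight_part) (rule transp_Nmat_weight)

lemma Xop_funpow_part: "(X ^^ p) (part c f) = part (c + 2 * real p) ((X ^^ p) f)"
  by (induction p) (simp_all add: Xop_part algebra_simps)

lemma weighted_Xop: "weighted c f \<Longrightarrow> weighted (c + 2) (X f)"
  unfolding Xop_def by (rule has_weight_DA) (rule transp_Nmat_weight)

lemma weighted_Yop: "weighted c f \<Longrightarrow> weighted (c - 2) (Y f)"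
  unfolding Yop_def using has_weight_DA[OF transp_Mmat_weight] by fastforce

lemma weighted_Yop_funpow: "weighted c f \<Longrightarrow> weighted (c - 2 * real p) ((Y ^^ p) f)"
  by (induction p) (auto dest: weighted_Yop simp: algebra_simps)

lemma supported_Xop_funpow: "supported f \<Longrightarrow> supported ((X ^^ p) f)"
  and supported_Yop_funpow: "supported f \<Longrightarrow> supported ((Y ^^ p) f)"
  by (simp_all add: Xop_def Yop_def supp_funpow_DA)

lemma weighted_scale: "weighted c f \<Longrightarrow> mweight (dimn ns) (triad_weight ns) m * f m = c * f m"
  by (cases "f m = 0") (auto simp: has_weight_def)

lemma Xop_Yop_weighted: "weighted c f \<Longrightarrow> X (Y f) = (\<lambda>m. Y (X f) m + c * f m)"
  by (rule ext) (simp only: Xop_Yop weighted_scale)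

text \<open>Each \<open>X\<close> moved past \<open>Y\<close> leaves the weight of the series it
  acts on as a scalar. The innermost \<open>X\<close> is moved first, so the induction hypothesis is
  applied to \<open>X f\<close> of weight \<open>c + 2\<close>.\<close>

lemma Xop_funpow_Yop:
  assumes "weighted c f"
  shows "(X ^^ Suc q) (Y f) = (\<lambda>m. Y ((X ^^ Suc q) f) m + real (Suc q) * (c + real q) * (X ^^ q) f m)"
  using assms
proof (induction q arbitrary: c f)
  case 0
  then show ?case by (simp add: Xop_Yop_weighted)
next
  case (Suc q)
  have "X (Y f) = (\<lambda>m. Y (X f) m + c * f m)" using Suc.prems by (rule Xop_Yop_weighted)
  then have "(X ^^ Suc (Suc q)) (Y f) = (X ^^ Suc q) (\<lambda>m. Y (X f) m + c * f m)"
    by (simp only: funpow_Suc_right[of "Suc q"] comp_def)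
  also have "\<dots> = (\<lambda>m. (X ^^ Suc q) (Y (X f)) m + c * (X ^^ Suc q) f m)"
    by (simp only: row_finite_add[OF row_finite_Xop_funpow] row_finite_scale[OF row_finite_Xop_funpow])
  also have "\<dots> = (\<lambda>m. Y ((X ^^ Suc q) (X f)) m + real (Suc q) * (c + 2 + real q) * (X ^^ q) (X f) m
      + c * (X ^^ Suc q) f m)"
    by (simp only: Suc.IH[OF weighted_Xop[OF Suc.prems]])
  also have "\<dots> = (\<lambda>m. Y ((X ^^ Suc (Suc q)) f) m
      + (real (Suc q) * (c + 2 + real q) + c) * (X ^^ Suc q) f m)"
    by (simp only: funpow_Suc_right comp_def) (simp add: algebra_simps)
  also have "real (Suc q) * (c + 2 + real q) + c = real (Suc (Suc q)) * (c + real (Suc q))"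
    by (simp add: algebra_simps)
  finally show ?case .
qed

text \<open>The successive images under \<open>Y\<close> have weights \<open>c - 2 * i\<close>;
  summed over \<open>i\<close> from 0 to \<open>s\<close> these give
  \<open>(s+1)(c-s)\<close>.\<close>

lemma Xop_Yop_funpow:
  assumes "X f = (\<lambda>_. 0)" "weighted c f"
  shows "X ((Y ^^ Suc s) f) = (\<lambda>m. real (Suc s) * (c - real s) * (Y ^^ s) f m)"
proof (induction s)
  case 0
  then show ?case using assms by (simp add: Xop_Yop_weighted row_finite_zero[OF row_finite_Yop])
next
  case (Suc s)
  have "X ((Y ^^ Suc (Suc s)) f) = (\<lambda>m. Y (X ((Y ^^ Suc s) f)) m + (c - 2 * real (Suc s)) * (Y ^^ Suc s) f m)"
    using Xop_Yop_weighted[OF weighted_Yop_funpow[OF assms(2), of "Suc s"]] by simp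
  also have "\<dots> = (\<lambda>m. (real (Suc s) * (c - real s) + (c - 2 * real (Suc s))) * (Y ^^ Suc s) f m)"
    unfolding Suc.IH row_finite_scale[OF row_finite_Yop] by (simp add: algebra_simps)
  also have "real (Suc s) * (c - real s) + (c - 2 * real (Suc s)) = real (Suc (Suc s)) * (c - real (Suc s))"
    by (simp add: algebra_simps)
  finally show ?case .
qed

text \<open>Each \<open>Y\<close> lowers the weight by 2 and keeps the degree, while a monomial of
  degree \<open>d\<close> has weight at least \<open>- C * d\<close>.\<close>

lemma weighted_Yop_funpow_eventually_zero:
  assumes "weighted c f" "has_weight (dimn ns) (\<lambda>_. 1) d f"
  shows "\<exists>l. (Y ^^ l) f = (\<lambda>_. 0)"
proof -
  define C where "C = (\<Sum>i<dimn ns. \<bar>triad_weight ns i\<bar>)"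
  \<comment> \<open>The absolute value covers \<open>f = 0\<close>, where \<open>d\<close> may be
    negative; at a nonzero coefficient \<open>d\<close> is a degree.\<close>
  obtain l :: nat where l: "C * \<bar>d\<bar> + c < real l" using reals_Archimedean2 by blast
  have deg: "has_weight (dimn ns) (\<lambda>_. 1) d ((Y ^^ l) f)"
  proof (induction l)
    case (Suc l)
    have "has_weight (dimn ns) (\<lambda>_. 1) (d + 0) (Y ((Y ^^ l) f))"
      unfolding Yop_def by (rule has_weight_DA) (use Suc in \<open>auto simp: Yop_def\<close>)
    then show ?case by simp
  qed (use assms in simp)
  have "(Y ^^ l) f m = 0" for m
  proof (rule ccontr)
    assume nz: "(Y ^^ l) f m \<noteq> 0"
    have w: "mweight (dimn ns) (triad_weight ns) m = c - 2 * real l" and d: "d = (\<Sum>i<dimn ns. real (m i))"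
      using nz weighted_Yop_funpow[OF assms(1), of l] deg by (auto simp: has_weight_def mweight_def)
    have "- (C * d) = (\<Sum>i<dimn ns. - (\<bar>triad_weight ns i\<bar> * d))"
      by (simp add: C_def sum_distrib_right sum_negf)
    also have "\<dots> \<le> (\<Sum>i<dimn ns. triad_weight ns i * real (m i))"
    proof (rule sum_mono)
      fix i assume "i \<in> {..<dimn ns}"
      then have "real (m i) \<le> d" unfolding d by (intro member_le_sum) auto
      then have "\<bar>triad_weight ns i\<bar> * real (m i) \<le> \<bar>triad_weight ns i\<bar> * d"
        by (intro mult_left_mono) auto
      moreover have "- (\<bar>triad_weight ns i\<bar> * real (m i)) \<le> triad_weight ns i * real (m i)"
        by (metis abs_ge_minus_self minus_le_iff minus_mult_left mult_right_mono of_nat_0_le_iff)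
      ultimately show "- (\<bar>triad_weight ns i\<bar> * d) \<le> triad_weight ns i * real (m i)" by linarith
    qed
    also have "\<dots> = c - 2 * real l" using w by (simp add: mweight_def)
    finally have "2 * real l \<le> c + C * d" by linarith
    moreover have "d = \<bar>d\<bar>" unfolding d by (simp add: sum_nonneg)
    ultimately show False using l by auto
  qed
  then show ?thesis by blast
qed

text \<open>In a finite-dimensional representation a nonzero vector of weight \<open>c\<close> is not annihilated by
  \<open>X ^^ q\<close> for \<open>q \<le> - c\<close>. Here finite dimensionality is replaced by the fact that \<open>Y\<close> is nilpotent
  on each homogeneous part: if \<open>f\<close> has weight \<open>c \<le> - Suc q\<close> and lies in the kernel of \<open>X ^^ Suc q\<close>,
  then \<open>(X ^^ (q + l)) ((Y ^^ l) f)\<close> is a nonzero multiple of \<open>(X ^^ q) f\<close> for every \<open>l\<close>.\<close>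

lemma Xop_funpow_injective_homogeneous:
  assumes "weighted c f" "has_weight (dimn ns) (\<lambda>_. 1) d f" "real q \<le> - c" "(X ^^ q) f = (\<lambda>_. 0)"
  shows "f = (\<lambda>_. 0)"
  using assms(3,4)
proof (induction q)
  case (Suc q)
  have "(X ^^ Suc (q + l)) ((Y ^^ l) f) = (\<lambda>_. 0) \<and>
      (\<exists>a. a \<noteq> 0 \<and> (X ^^ (q + l)) ((Y ^^ l) f) = (\<lambda>m. a * (X ^^ q) f m))" for l
  proof (induction l)
    case 0
    show ?case using Suc.prems(2) by (auto intro!: exI[of _ 1])
  next
    case (Suc l)
    let ?g = "(Y ^^ l) f"
    have g: "weighted (c - 2 * real l) ?g" using assms(1) by (rule weighted_Yop_funpow)
    have 0: "(X ^^ Suc (q + l)) ?g = (\<lambda>_. 0)" using Suc by blast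
    then have 1: "(X ^^ Suc (Suc (q + l))) ?g = (\<lambda>_. 0)"
      by (simp add: row_finite_zero[OF row_finite_Xop])
    obtain a where a: "a \<noteq> 0" "(X ^^ (q + l)) ?g = (\<lambda>m. a * (X ^^ q) f m)" using Suc by blast
    let ?b = "real (Suc (q + l)) * (c - 2 * real l + real (q + l))"
    have "(X ^^ Suc (q + l)) (Y ?g) = (\<lambda>m. (?b * a) * (X ^^ q) f m)"
      unfolding Xop_funpow_Yop[OF g] 0 a(2) row_finite_zero[OF row_finite_Yop] by (simp add: mult.assoc)
    \<comment> \<open>The sum equals \<open>c + q - l\<close>, at most \<open>- 1 - l\<close> by the
      bound on \<open>c\<close>, so the new multiple stays nonzero.\<close>
    moreover have "c - 2 * real l + real (q + l) < 0" using \<open>real (Suc q) \<le> - c\<close> by simp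
    then have "?b * a \<noteq> 0" using a(1) by simp
    moreover have "(X ^^ Suc (Suc (q + l))) (Y ?g) = (\<lambda>_. 0)"
      unfolding Xop_funpow_Yop[OF g] 0 1 row_finite_zero[OF row_finite_Yop] by simp
    ultimately show ?case
      by (metis (no_types, lifting) add_Suc_right comp_apply funpow.simps(2))
  qed
  moreover obtain l where "(Y ^^ l) f = (\<lambda>_. 0)"
    using weighted_Yop_funpow_eventually_zero assms(1,2) by blast
  ultimately obtain a where "a \<noteq> 0" "(X ^^ (q + l)) (\<lambda>_. 0) = (\<lambda>m. a * (X ^^ q) f m)"
    by metis
  \<comment> \<open>Once \<open>(Y ^^ l) f\<close> is 0, so is a nonzero multiple of
    \<open>(X ^^ q) f\<close>, and the hypothesis for \<open>q\<close> applies.\<close>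
  then have "(X ^^ q) f = (\<lambda>_. 0)"
    by (auto simp: row_finite_zero[OF row_finite_Xop_funpow] fun_eq_iff)
  then show ?case using Suc.IH Suc.prems(1) by simp
qed simp

text \<open>A series may involve infinitely many degrees, but \<open>X\<close> preserves degree. For
  each monomial \<open>m\<close> it suffices to treat the homogeneous part that contains it.\<close>

lemma Xop_funpow_injective:
  assumes "weighted c f" "real q \<le> - c" "(X ^^ q) f = (\<lambda>_. 0)"
  shows "f = (\<lambda>_. 0)"
proof
  fix m
  let ?d = "mweight (dimn ns) (\<lambda>_. 1) m"
  let ?g = "weight_part (dimn ns) (\<lambda>_. 1) ?d f"
  have "X (weight_part (dimn ns) (\<lambda>_. 1) ?d h) = weight_part (dimn ns) (\<lambda>_. 1) ?d (X h)" for h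
    unfolding Xop_def using DA_weight_part[of "dimn ns" _ "\<lambda>_. 1" 0] by simp
  then have "(X ^^ q) ?g = weight_part (dimn ns) (\<lambda>_. 1) ?d ((X ^^ q) f)"
    by (induction q) simp_all
  then have "(X ^^ q) ?g = (\<lambda>_. 0)" by (simp add: assms(3) weight_part_def)
  moreover have "weighted c ?g" using assms(1) by (simp add: has_weight_def weight_part_def)
  ultimately have "?g = (\<lambda>_. 0)"
    using Xop_funpow_injective_homogeneous has_weight_weight_part assms(2) by blast
  then have "?g m = 0" by metis
  then show "f m = 0" by (simp add: weight_part_def)
qed

text \<open>This is \<open>s!\<close> times the falling factorial
  \<open>c (c-1) ... (c-s+1)\<close>, the scalar by which \<open>X ^^ s\<close> after
  \<open>Y ^^ s\<close> acts on a kernel element of \<open>X\<close> of weight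
  \<open>c\<close>.\<close>

definition lowering_coeff :: "real \<Rightarrow> nat \<Rightarrow> real" where
  "lowering_coeff c s = (\<Prod>i<s. real (Suc i) * (c - real i))"

lemma lowering_coeff_nonzero: "real s \<le> c \<Longrightarrow> lowering_coeff c s \<noteq> 0"
  by (auto simp: lowering_coeff_def)

lemma Xop_funpow_Yop_funpow_same:
  assumes "X f = (\<lambda>_. 0)" "weighted c f"
  shows "(X ^^ s) ((Y ^^ s) f) = (\<lambda>m. lowering_coeff c s * f m)"
proof (induction s)
  case 0
  show ?case by (simp add: lowering_coeff_def)
next
  case (Suc s)
  have "(X ^^ Suc s) ((Y ^^ Suc s) f) = (X ^^ s) (X ((Y ^^ Suc s) f))"
    by (simp only: funpow_Suc_right comp_apply)
  also have "\<dots> = (\<lambda>m. lowering_coeff c (Suc s) * f m)"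
    unfolding Xop_Yop_funpow[OF assms] row_finite_scale[OF row_finite_Xop_funpow] Suc
    by (simp add: lowering_coeff_def mult_ac)
  finally show ?case .
qed

text \<open>The power \<open>X ^^ s\<close> brings \<open>(Y ^^ s) f\<close> back to a multiple of
  \<open>f\<close>, and one more \<open>X\<close> kills it.\<close>

lemma Xop_funpow_Yop_funpow_zero:
  assumes "X f = (\<lambda>_. 0)" "weighted c f" "s < t"
  shows "(X ^^ t) ((Y ^^ s) f) = (\<lambda>_. 0)"
proof -
  have "t = (t - Suc s) + Suc s" using assms(3) by simp
  then have "(X ^^ t) ((Y ^^ s) f) = (X ^^ (t - Suc s)) (X ((X ^^ s) ((Y ^^ s) f)))"
    by (metis comp_apply funpow.simps(2) funpow_add)
  then show ?thesis
    by (simp add: Xop_funpow_Yop_funpow_same[OF assms(1,2)] row_finite_scale[OF row_finite_Xop]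
        assms(1) row_finite_zero[OF row_finite_Xop_funpow])
qed

section \<open>Transvectants\<close>

text \<open>A row of the transposed \<open>N\<close> has at most one nonzero entry, pointing to the
  row above in the same block. Each row of the kernel equation therefore either produces the
  component above or, at the top of a block, demands that \<open>X\<close> kill the
  component.\<close>

lemma Eset_iff:
  "v \<in> Eset ns \<longleftrightarrow> supp_vf (dimn ns) v \<and>
     (\<forall>r j i k. loc ns r = Some (j, i, k) \<longrightarrow> X (v r) = (if 0 < i then v (r - 1) else (\<lambda>_. 0)))"
proof -
  let ?n = "dimn ns"
  have row: "(LA ?n (transp (Nmat ns)) v r = (\<lambda>_. 0)) \<longleftrightarrow> X (v r) = (if 0 < i then v (r - 1) else (\<lambda>_. 0))"
    if r: "loc ns r = Some (j, i, k)" for r j i k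
  proof -
    have "(\<Sum>c<?n. transp (Nmat ns) r c * v c m) = (if 0 < i then v (r - 1) m else 0)" for m
    proof (cases i)
      case 0
      then show ?thesis by (simp add: transp_def Nmat_col[OF r])
    next
      case (Suc l)
      then have "r = Suc (r - 1)" using r by (auto simp: loc_eq_Some_iff)
      then have "(\<Sum>c<?n. transp (Nmat ns) r c * v c m) = (\<Sum>c<?n. if c = r - 1 then v (r - 1) m else 0)"
        by (intro sum.cong refl) (use Suc in \<open>auto simp: transp_def Nmat_col[OF r]\<close>)
      moreover have "r - 1 < dimn ns" using loc_less_dimn[OF r] by simp
      ultimately show ?thesis using Suc by simp
    qed
    then show ?thesis by (auto simp: LA_def Xop_def fun_eq_iff)
  qed
  have out: "LA ?n (transp (Nmat ns)) v r = (\<lambda>_. 0)" if "supp_vf ?n v" "loc ns r = None" for r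
  proof -
    have "v r = (\<lambda>_. 0)" using that by (simp add: supp_vf_def loc_eq_None_iff)
    moreover have "transp (Nmat ns) r c = 0" for c
      using that(2) by (simp add: transp_def Nmat_def split: option.splits)
    ultimately show ?thesis by (simp add: LA_def row_finite_zero[OF row_finite_DA])
  qed
  show ?thesis
  proof
    assume v: "v \<in> Eset ns"
    then have "LA ?n (transp (Nmat ns)) v r = (\<lambda>_. 0)" for r by (simp add: Eset_def)
    then show "supp_vf ?n v \<and>
     (\<forall>r j i k. loc ns r = Some (j, i, k) \<longrightarrow> X (v r) = (if 0 < i then v (r - 1) else (\<lambda>_. 0)))"
      using v row by (simp add: Eset_def)
  next
    assume v: "supp_vf ?n v \<and>
     (\<forall>r j i k. loc ns r = Some (j, i, k) \<longrightarrow> X (v r) = (if 0 < i then v (r - 1) else (\<lambda>_. 0)))"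
    have "LA ?n (transp (Nmat ns)) v r = (\<lambda>_. 0)" for r
    proof (cases "loc ns r")
      case None
      then show ?thesis using v out by blast
    next
      case (Some p)
      obtain j i k where "p = (j, i, k)" by (cases p)
      then show ?thesis using v row[of r j i k] Some by blast
    qed
    then show "v \<in> Eset ns" using v by (auto simp: Eset_def)
  qed
qed

lemma loc_bottom_row:
  assumes "j < length ns" "0 < ns ! j"
  shows "loc ns (bottom_row ns j) = Some (j, ns ! j - 1, ns ! j)"
  using assms by (simp add: loc_eq_Some_iff bottom_row_def)

lemma Eset_component:
  assumes v: "v \<in> Eset ns" and r: "loc ns r = Some (j, i, k)"
  shows "v r = (X ^^ (k - 1 - i)) (v (bottom_row ns j))"
proof -
  have jk: "j < length ns" "k = ns ! j" "i < k" and rr: "r = sum_list (take j ns) + i"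
    using r by (auto simp: loc_eq_Some_iff)
  have "v (bottom_row ns j - t) = (X ^^ t) (v (bottom_row ns j))" if "t < k" for t
    using that
  proof (induction t)
    case (Suc t)
    have "loc ns (bottom_row ns j - t) = Some (j, k - 1 - t, k)"
      using jk Suc.prems by (auto simp: loc_eq_Some_iff bottom_row_def)
    then have "X (v (bottom_row ns j - t)) = v (bottom_row ns j - t - 1)"
      using v Suc.prems unfolding Eset_iff by simp
    then show ?case using Suc by simp
  qed simp
  from this[of "k - 1 - i"] show ?thesis using jk rr by (simp add: bottom_row_def)
qed

text \<open>The top component is \<open>X ^^ (ns ! j - 1)\<close> of the bottom one, and the top row
  of the block asks for one further \<open>X\<close>.\<close>

lemma Eset_bottom_kernel:
  assumes v: "v \<in> Eset ns" and j: "j < length ns" "0 < ns ! j"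
  shows "(X ^^ (ns ! j)) (v (bottom_row ns j)) = (\<lambda>_. 0)"
proof -
  let ?r = "sum_list (take j ns)"
  have r: "loc ns ?r = Some (j, 0, ns ! j)" using j by (simp add: loc_eq_Some_iff)
  have "X (v ?r) = (\<lambda>_. 0)" using v r unfolding Eset_iff by (metis less_irrefl)
  moreover have "v ?r = (X ^^ (ns ! j - 1)) (v (bottom_row ns j))" using Eset_component[OF v r] by simp
  ultimately have "(X ^^ Suc (ns ! j - 1)) (v (bottom_row ns j)) = (\<lambda>_. 0)" by simp
  then show ?thesis using j by simp
qed

text \<open>Each factor moves the basis vector up one row. The entries \<open>a(k-a)\<close> met on
  the way, for \<open>a\<close> from \<open>k-1\<close> down to \<open>k-t\<close>, multiply to
  \<open>(k-1)!/(k-1-t)!\<close> times \<open>t!\<close>.\<close>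

lemma matvec_power_bvec:
  assumes j: "j < length ns" "0 < ns ! j" and r: "loc ns r = Some (j', i, k)"
  shows "(matvec (dimn ns) (\<lambda>a b. - transp (Mmat ns) a b) ^^ t) (bvec ns j) r
    = (if j' = j \<and> t + Suc i = ns ! j
       then (- 1) ^ t * fact t * (fact (ns ! j - 1) / fact (ns ! j - 1 - t)) else 0)"
  using r
proof (induction t arbitrary: r i k)
  case 0
  have "r = bottom_row ns j \<longleftrightarrow> j' = j \<and> Suc i = ns ! j"
  proof
    assume "r = bottom_row ns j"
    then have "(j', i, k) = (j, ns ! j - 1, ns ! j)"
      by (metis 0 loc_bottom_row[OF j] option.inject)
    then show "j' = j \<and> Suc i = ns ! j" using j by auto
  qed (use 0 in \<open>auto simp: loc_eq_Some_iff bottom_row_def\<close>)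
  then show ?case by (simp add: bvec_def)
next
  case (Suc t)
  let ?B = "matvec (dimn ns) (\<lambda>a b. - transp (Mmat ns) a b)"
  have k: "k = ns ! j'" using Suc.prems by (simp add: loc_eq_Some_iff)
  have "(?B ^^ Suc t) (bvec ns j) r
      = (\<Sum>c<dimn ns. - (Mmat ns c r) * (?B ^^ t) (bvec ns j) c)"
    by (simp add: matvec_def transp_def)
  also have "\<dots> = (if Suc i < k then - (real (Suc i) * real (k - Suc i)) * (?B ^^ t) (bvec ns j) (Suc r) else 0)"
  proof (cases "Suc i < k")
    case True
    have "(\<Sum>c<dimn ns. - (Mmat ns c r) * (?B ^^ t) (bvec ns j) c) = (\<Sum>c<dimn ns. if c = Suc r
        then - (real (Suc i) * real (k - Suc i)) * (?B ^^ t) (bvec ns j) (Suc r) else 0)"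
      by (intro sum.cong refl) (simp add: Mmat_col[OF Suc.prems] True)
    then show ?thesis using True loc_less_dimn[OF loc_Suc[OF Suc.prems True]] by simp
  next
    case False
    then show ?thesis by (simp add: Mmat_col[OF Suc.prems])
  qed
  also have "\<dots> = (if j' = j \<and> Suc t + Suc i = ns ! j
       then (- 1) ^ Suc t * fact (Suc t) * (fact (ns ! j - 1) / fact (ns ! j - 1 - Suc t)) else 0)"
  proof (cases "j' = j \<and> Suc t + Suc i = ns ! j")
    case True
    then have si: "Suc i < k" "k - Suc i = Suc t" using k by auto
    have "ns ! j - 1 - t = Suc i" "ns ! j - 1 - Suc t = i" using True by auto
    then show ?thesis using True si Suc.IH[OF loc_Suc[OF Suc.prems si(1)]]
      by (simp add: field_simps del: of_nat_Suc)
  next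
    case False
    then show ?thesis using Suc.IH[OF loc_Suc[OF Suc.prems]] k by auto
  qed
  finally show ?case .
qed

lemma matvec_power_bvec_outside:
  assumes "j < length ns" "0 < ns ! j" "dimn ns \<le> r"
  shows "(matvec (dimn ns) (\<lambda>a b. - transp (Mmat ns) a b) ^^ t) (bvec ns j) r = 0"
proof (cases t)
  case 0
  then show ?thesis
    using loc_less_dimn[OF loc_bottom_row[OF assms(1,2)]] assms(3) by (simp add: bvec_def)
next
  case (Suc t')
  have "loc ns r = None" using assms by (simp add: loc_eq_None_iff)
  then have "Mmat ns c r = 0" for c by (simp add: Mmat_def split: option.splits)
  then show ?thesis using Suc by (simp add: matvec_def transp_def)
qed

text \<open>Only the summand with \<open>s - i = t\<close> contributes to the component \<open>t\<close> rows above the bottom of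
  block \<open>j\<close>; this is its coefficient.\<close>

definition transv_coeff :: "nat \<Rightarrow> nat \<Rightarrow> nat \<Rightarrow> nat \<Rightarrow> real" where
  "transv_coeff fw ww s t = (- 1) ^ s * (fact s / fact (s - t)) * (fact (fw - s + t) / fact (fw - s))
     * (fact ww / fact (ww - s))"

lemma transv_coeff_nonzero: "transv_coeff fw ww s t \<noteq> 0"
  by (simp add: transv_coeff_def)

text \<open>The powers of the matrix applied to the bottom vector sit in pairwise different rows, so
  a given row selects at most one summand. The binomial then cancels the \<open>t!\<close> of the
  matrix power.\<close>

lemma transvectant_component:
  assumes j: "j < length ns" "0 < ns ! j" and s: "s \<le> fw" "s \<le> ns ! j - 1"
    and r: "loc ns r = Some (j', i, k)"
  shows "transvectant ns f fw (bvec ns j) (ns ! j - 1) s r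
    = (if j' = j \<and> k - 1 - i \<le> s
       then (\<lambda>m. transv_coeff fw (ns ! j - 1) s (k - 1 - i) * (Y ^^ (s - (k - 1 - i))) f m) else (\<lambda>_. 0))"
proof
  fix m
  let ?ww = "ns ! j - 1" and ?t = "k - 1 - i"
  have ik: "i < k" "k = ns ! j'" using r by (auto simp: loc_eq_Some_iff)
  let ?c = "\<lambda>l. (-1) ^ l * real (s choose l) * (fact (fw - l) / fact (fw - s))
        * (fact (?ww - s + l) / fact (?ww - s)) * ((Y ^^ l) f m)"
  let ?\<beta> = "\<lambda>t. (- 1) ^ t * fact t * (fact ?ww / fact (?ww - t)) :: real"
  have "transvectant ns f fw (bvec ns j) ?ww s r m
      = (\<Sum>l\<le>s. ?c l * (if j' = j \<and> s - l + Suc i = ns ! j then ?\<beta> (s - l) else 0))"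
    unfolding transvectant_def matvec_power_bvec[OF j r] by simp
  also have "\<dots> = (\<Sum>l\<le>s. if l = s - ?t then (if j' = j \<and> ?t \<le> s then ?c (s - ?t) * ?\<beta> ?t else 0) else 0)"
  proof (rule sum.cong[OF refl])
    fix l assume "l \<in> {..s}"
    then have "j' = j \<and> s - l + Suc i = ns ! j \<longleftrightarrow> l = s - ?t \<and> j' = j \<and> ?t \<le> s"
      using ik by auto
    then show "?c l * (if j' = j \<and> s - l + Suc i = ns ! j then ?\<beta> (s - l) else 0)
        = (if l = s - ?t then (if j' = j \<and> ?t \<le> s then ?c (s - ?t) * ?\<beta> ?t else 0) else 0)"
      by auto
  qed
  also have "\<dots> = (if j' = j \<and> ?t \<le> s then ?c (s - ?t) * ?\<beta> ?t else 0)" by simp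
  also have "\<dots> = (if j' = j \<and> ?t \<le> s then transv_coeff fw ?ww s ?t * (Y ^^ (s - ?t)) f m else 0)"
  proof (cases "?t \<le> s")
    case True
    define t where "t = ?t"
    have t: "t \<le> s" using True t_def by simp
    have "fw - (s - t) = fw - s + t" "?ww - s + (s - t) = ?ww - t" using s t by auto
    moreover have "real (s choose (s - t)) = fact s / (fact (s - t) * fact t)"
      using binomial_fact[of "s - t" s] t by simp
    moreover have "(-1 :: real) ^ (s - t) * (-1) ^ t = (-1) ^ s"
      using t by (simp flip: power_add)
    then have "(-1 :: real) ^ (s - t) = (-1) ^ s * (-1) ^ t"
      by (metis (no_types, lifting) left_minus_one_mult_self mult.commute)
    \<comment> \<open>The sign \<open>(-1) ^ t\<close> now occurs twice; the case distinction
      removes its square.\<close>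
    moreover have "(-1 :: real) ^ t = 1 \<or> (-1 :: real) ^ t = -1" by (simp add: minus_one_power_iff)
    ultimately have "?c (s - t) * ?\<beta> t = transv_coeff fw ?ww s t * (Y ^^ (s - t)) f m"
      by (auto simp: transv_coeff_def mult_ac)
    then show ?thesis unfolding t_def by (simp only:)
  qed simp
  finally show "transvectant ns f fw (bvec ns j) ?ww s r m
    = (if j' = j \<and> ?t \<le> s then (\<lambda>m. transv_coeff fw ?ww s ?t * (Y ^^ (s - ?t)) f m) else (\<lambda>_. 0)) m"
    by simp
qed

lemma transvectant_outside:
  assumes "j < length ns" "0 < ns ! j" "dimn ns \<le> r"
  shows "transvectant ns f fw (bvec ns j) ww s r = (\<lambda>_. 0)"
  unfolding transvectant_def by (simp add: matvec_power_bvec_outside[OF assms])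

lemma transvectant_bottom:
  assumes j: "j < length ns" "0 < ns ! j" and s: "s \<le> fw" "s \<le> ns ! j - 1"
    and l: "l < length ns" "0 < ns ! l"
  shows "transvectant ns f fw (bvec ns j) (ns ! j - 1) s (bottom_row ns l)
    = (if l = j then (\<lambda>m. transv_coeff fw (ns ! j - 1) s 0 * (Y ^^ s) f m) else (\<lambda>_. 0))"
  using transvectant_component[OF j s loc_bottom_row[OF l]] by auto

text \<open>In the row \<open>t\<close> steps above the bottom, \<open>X\<close> multiplies by
  \<open>(s-t)(fw-s+t+1)\<close> and lowers the exponent of \<open>Y\<close> by one. This factor is
  the ratio of consecutive values of \<open>transv_coeff\<close>, so the rows satisfy
  \<open>Eset_iff\<close>.\<close>

lemma transvectant_in_Eset:
  assumes j: "j < length ns" "0 < ns ! j" and s: "s \<le> fw" "s \<le> ns ! j - 1"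
    and f: "supported f" "X f = (\<lambda>_. 0)" "weighted (real fw) f"
  shows "transvectant ns f fw (bvec ns j) (ns ! j - 1) s \<in> Eset ns"
proof -
  let ?v = "transvectant ns f fw (bvec ns j) (ns ! j - 1) s"
  let ?a = "transv_coeff fw (ns ! j - 1) s"
  have "supported (?v r)" for r
  proof (cases "loc ns r")
    case None
    then show ?thesis using transvectant_outside[OF j] by (simp add: loc_eq_None_iff supp_fps_def)
  next
    case (Some p)
    obtain j' i k where "p = (j', i, k)" by (cases p)
    then have "loc ns r = Some (j', i, k)" using Some by simp
    then show ?thesis unfolding transvectant_component[OF j s \<open>loc ns r = Some (j', i, k)\<close>]
      using supported_Yop_funpow[OF f(1)] by (auto simp: supp_fps_def)
  qed
  then have "supp_vf (dimn ns) ?v" using transvectant_outside[OF j] by (simp add: supp_vf_def)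
  moreover have "X (?v r) = (if 0 < i then ?v (r - 1) else (\<lambda>_. 0))"
    if r: "loc ns r = Some (j', i, k)" for r j' i k
  proof -
    define t where "t = k - 1 - i"
    have ik: "i < k" "k = ns ! j'" using r by (auto simp: loc_eq_Some_iff)
    have vr: "?v r = (if j' = j \<and> t \<le> s then (\<lambda>m. ?a t * (Y ^^ (s - t)) f m) else (\<lambda>_. 0))"
      unfolding t_def by (rule transvectant_component[OF j s r])
    have prev: "?v (r - 1) = (if j' = j \<and> Suc t \<le> s then (\<lambda>m. ?a (Suc t) * (Y ^^ (s - Suc t)) f m) else (\<lambda>_. 0))"
      if "0 < i"
    proof -
      have "loc ns (r - 1) = Some (j', i - 1, k)" using loc_pred[of ns r j' "i - 1" k] r that by simp
      moreover have "k - 1 - (i - 1) = Suc t" using that ik by (simp add: t_def)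
      ultimately show ?thesis using transvectant_component[OF j s, of "r - 1" j' "i - 1" k] by simp
    qed
    show ?thesis
    proof (cases "j' = j \<and> Suc t \<le> s")
      case True
      \<comment> \<open>Since \<open>s\<close> is at most the block size minus one,
        \<open>Suc t \<le> s\<close> keeps this row below the top of the block.\<close>
      then have i: "0 < i" using ik s unfolding t_def by (cases i) auto
      have "X (?v r) = (\<lambda>m. ?a t * X ((Y ^^ Suc (s - Suc t)) f) m)"
        using True vr by (simp add: row_finite_scale[OF row_finite_Xop] Suc_diff_Suc)
      also have "\<dots> = (\<lambda>m. ?a t * (real (Suc (s - Suc t)) * (real fw - real (s - Suc t))) * (Y ^^ (s - Suc t)) f m)"
        unfolding Xop_Yop_funpow[OF f(2,3)] by (simp add: mult.assoc)
      also have "?a t * (real (Suc (s - Suc t)) * (real fw - real (s - Suc t))) = ?a (Suc t)"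
      proof -
        have "real fw - real (s - Suc t) = real (Suc (fw - s + t))" using True s by (simp add: of_nat_diff)
        moreover have "s - t = Suc (s - Suc t)" using True by (simp add: Suc_diff_Suc)
        ultimately show ?thesis
          by (simp add: transv_coeff_def field_simps del: of_nat_Suc)
      qed
      finally show ?thesis using prev[OF i] i True by simp
    next
      case False
      \<comment> \<open>Either the component is 0, or \<open>t = s\<close> and it is a multiple of
        \<open>f\<close> itself.\<close>
      have "X (?v r) = (\<lambda>_. 0)"
        using False vr f(2) by (cases "j' = j \<and> t = s")
          (auto simp: row_finite_scale[OF row_finite_Xop] row_finite_zero[OF row_finite_Xop])
      then show ?thesis using prev False by auto
    qed
  qed
  ultimately show ?thesis unfolding Eset_iff by blast
qed

section \<open>Formal bases of the kernels of the powers of X\<close>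

text \<open>Only these properties of the invariant monomials enter: they form a formal basis of the
  kernel of \<open>X\<close> consisting of weight vectors. The index type is left abstract.\<close>

context
  fixes A :: "'k set" and g :: "'k \<Rightarrow> fps_n" and w :: "'k \<Rightarrow> nat"
  assumes g_supported: "\<And>k. k \<in> A \<Longrightarrow> supported (g k)"
    and g_kernel: "\<And>k. k \<in> A \<Longrightarrow> X (g k) = (\<lambda>_. 0)"
    and g_weighted: "\<And>k. k \<in> A \<Longrightarrow> weighted (real (w k)) (g k)"
    and g_indep: "formal_indep g A"
    and g_span: "\<And>f. supported f \<Longrightarrow> X f = (\<lambda>_. 0) \<Longrightarrow> formal_comb g A f"
begin

definition lowered :: "'k \<times> nat \<Rightarrow> fps_n" where
  "lowered = (\<lambda>(k, s). (Y ^^ s) (g k))"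

definition lowered_index :: "nat \<Rightarrow> ('k \<times> nat) set" where
  "lowered_index p = {(k, s). k \<in> A \<and> s \<le> w k \<and> s < p}"

lemma lowered_index_Suc:
  "lowered_index (Suc p) = lowered_index p \<union> (\<lambda>k. (k, p)) ` {k\<in>A. p \<le> w k}"
  by (auto simp: lowered_index_def)

lemma lowered_index_disjoint: "lowered_index p \<inter> (\<lambda>k. (k, p)) ` {k\<in>A. p \<le> w k} = {}"
  by (auto simp: lowered_index_def)

text \<open>The weight-\<open>\<mu>\<close> part of a kernel element \<open>(X ^^ p) u\<close> comes from the part of \<open>u\<close> of weight
  \<open>\<mu> - 2 * p\<close>, which vanishes by injectivity when \<open>\<mu> < p\<close>.\<close>

lemma coefficients_of_image:
  assumes "(X ^^ Suc p) u = (\<lambda>_. 0)" and c: "has_fsum (\<lambda>k m. c k * g k m) A ((X ^^ p) u)"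
    and k: "k \<in> A" "w k < p"
  shows "c k = 0"
proof -
  let ?\<mu> = "real (w k)"
  have "(X ^^ Suc p) (part (?\<mu> - 2 * real p) u) = (\<lambda>_. 0)"
    unfolding Xop_funpow_part assms(1) by (simp add: weight_part_def)
  then have "part (?\<mu> - 2 * real p) u = (\<lambda>_. 0)"
    \<comment> \<open>With exponent \<open>p + 1\<close> the required bound is
      \<open>p + 1 \<le> 2 * p - w k\<close>, which is \<open>w k < p\<close>.\<close>
    by (rule Xop_funpow_injective[OF has_weight_weight_part, rotated]) (use k in simp)
  then have "(X ^^ p) (part (?\<mu> - 2 * real p) u) = (\<lambda>_. 0)"
    by (simp add: row_finite_zero[OF row_finite_Xop_funpow])
  then have "part ?\<mu> ((X ^^ p) u) = (\<lambda>_. 0)" by (simp add: Xop_funpow_part)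
  moreover have "has_fsum (\<lambda>k. part ?\<mu> (\<lambda>m. c k * g k m)) A (part ?\<mu> ((X ^^ p) u))"
    by (rule row_finite_has_fsum[OF row_finite_weight_part c])
  ultimately have "has_fsum (\<lambda>l. part ?\<mu> (\<lambda>m. c l * g l m)) A (\<lambda>_. 0)" by simp
  \<comment> \<open>Projection to one weight keeps exactly the terms with that weight, so
    independence of \<open>g\<close> applies to the truncated coefficients.\<close>
  then have "has_fsum (\<lambda>l m. (if w l = w k then c l else 0) * g l m) A (\<lambda>_. 0)"
  proof (rule has_fsum_cong)
    fix l assume "l \<in> A"
    then have "part ?\<mu> (g l) = (\<lambda>m. if w l = w k then g l m else 0)"
      using weight_part_has_weight[OF g_weighted, of l] weight_part_other_weight[OF g_weighted, of l ?\<mu>]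
      by (cases "w l = w k") auto
    then show "part ?\<mu> (\<lambda>m. c l * g l m) = (\<lambda>m. (if w l = w k then c l else 0) * g l m)"
      by (simp add: row_finite_scale[OF row_finite_weight_part] fun_eq_iff)
  qed
  then have "(if w k = w k then c k else 0) = 0"
    by (rule formal_indepD[OF g_indep, where c = "\<lambda>l. if w l = w k then c l else 0"]) (rule k(1))
  then show ?thesis by simp
qed

text \<open>Expand \<open>(X ^^ p) u\<close> in the basis \<open>g\<close>; only weights at least
  \<open>p\<close> occur, so the lowering coefficients can be divided out. The resulting series
  \<open>u'\<close> of \<open>p\<close>-fold lowered terms has the same image under
  \<open>X ^^ p\<close> as \<open>u\<close>, and the difference is covered by the induction
  hypothesis.\<close>

lemma lowered_span:
  assumes "supported u" "(X ^^ p) u = (\<lambda>_. 0)"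
  shows "formal_comb lowered (lowered_index p) u"
  using assms
proof (induction p arbitrary: u)
  case 0
  then show ?case
    by (auto simp: formal_comb_def fsummable_def fsum_def lowered_index_def)
next
  case (Suc p)
  obtain c where c: "has_fsum (\<lambda>k m. c k * g k m) A ((X ^^ p) u)"
    using g_span[OF supported_Xop_funpow[OF Suc.prems(1)], of p] Suc.prems(2)
    by (auto simp: formal_comb_iff_has_fsum)
  have c0: "c k = 0" if "k \<in> A" "w k < p" for k
    using coefficients_of_image[OF Suc.prems(2) c that] .
  define a where "a = (\<lambda>k. lowering_coeff (real (w k)) p)"
  have a: "\<And>k. k \<in> A \<Longrightarrow> p \<le> w k \<Longrightarrow> a k \<noteq> 0"
    "\<And>k. k \<in> A \<Longrightarrow> (X ^^ p) ((Y ^^ p) (g k)) = (\<lambda>m. a k * g k m)"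
    by (simp_all add: a_def lowering_coeff_nonzero Xop_funpow_Yop_funpow_same[OF g_kernel g_weighted])
  let ?A = "{k\<in>A. p \<le> w k}"
  \<comment> \<open>The coefficients are chosen so that \<open>X ^^ p\<close> after
    \<open>Y ^^ p\<close> turns \<open>z\<close> into \<open>(X ^^ p) u\<close>.\<close>
  define z where "z = fsum (\<lambda>k m. c k / a k * g k m) ?A"
  have z: "has_fsum (\<lambda>k m. c k / a k * g k m) ?A z"
    using fsummable_rescale[of c g A "\<lambda>k. c k / a k" ?A] c by (simp add: has_fsum_def z_def)
  define u' where "u' = (Y ^^ p) z"
  have "has_fsum (\<lambda>k. (Y ^^ p) (\<lambda>m. c k / a k * g k m)) ?A u'"
    unfolding u'_def by (rule row_finite_has_fsum[OF row_finite_Yop_funpow z])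
  then have u': "has_fsum (\<lambda>k m. c k / a k * lowered (k, p) m) ?A u'"
    by (rule has_fsum_cong) (simp only: row_finite_scale[OF row_finite_Yop_funpow] lowered_def prod.case)
  have "has_fsum (\<lambda>k. (X ^^ p) (\<lambda>m. c k / a k * lowered (k, p) m)) ?A ((X ^^ p) u')"
    by (rule row_finite_has_fsum[OF row_finite_Xop_funpow u'])
  then have "has_fsum (\<lambda>k m. c k * g k m) ?A ((X ^^ p) u')"
  proof (rule has_fsum_cong)
    fix k assume "k \<in> ?A"
    then show "(X ^^ p) (\<lambda>m. c k / a k * lowered (k, p) m) = (\<lambda>m. c k * g k m)"
      by (simp only: row_finite_scale[OF row_finite_Xop_funpow] lowered_def prod.case) (simp add: a)
  qed
  moreover have "has_fsum (\<lambda>k m. c k * g k m) ?A ((X ^^ p) u)"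
    by (rule has_fsum_subset[OF c]) (auto simp: c0)
  ultimately have eq: "(X ^^ p) u' = (X ^^ p) u" by (simp add: has_fsum_def)
  have "supported z"
    by (rule has_fsum_supp[OF z]) (use g_supported in \<open>auto simp: supp_fps_def\<close>)
  then have "supported u'" by (simp add: u'_def supported_Yop_funpow)
  then have "supported (\<lambda>m. u m - u' m)" using Suc.prems(1) by (rule supp_fps_diff[rotated])
  moreover have "(X ^^ p) (\<lambda>m. u m - u' m) = (\<lambda>_. 0)"
    by (simp add: row_finite_diff[OF row_finite_Xop_funpow] eq)
  ultimately obtain d where d: "has_fsum (\<lambda>x m. d x * lowered x m) (lowered_index p) (\<lambda>m. u m - u' m)"
    using Suc.IH[of "\<lambda>m. u m - u' m"] unfolding formal_comb_iff_has_fsum by blast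
  \<comment> \<open>The second component tells the two families apart: it is below \<open>p\<close>
    on the old indices and equal to \<open>p\<close> on the new ones.\<close>
  define e where "e = (\<lambda>x. if snd x = p then c (fst x) / a (fst x) else d x)"
  have "has_fsum (\<lambda>x m. e x * lowered x m) (lowered_index p) (\<lambda>m. u m - u' m)"
    by (rule has_fsum_cong[OF d]) (auto simp: e_def lowered_index_def)
  moreover have "has_fsum (\<lambda>x m. e x * lowered x m) ((\<lambda>k. (k, p)) ` ?A) u'"
    using u' by (subst has_fsum_reindex) (auto simp: e_def inj_on_def)
  ultimately have "has_fsum (\<lambda>x m. e x * lowered x m) (lowered_index (Suc p)) (\<lambda>m. (u m - u' m) + u' m)"
    unfolding lowered_index_Suc by (rule has_fsum_Un_disjoint) (rule lowered_index_disjoint)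
  then show ?case unfolding formal_comb_iff_has_fsum by auto
qed

text \<open>Applying \<open>X ^^ p\<close> kills all terms with \<open>s < p\<close> and turns those
  with \<open>s = p\<close> into nonzero multiples of the \<open>g k\<close>. So the top
  coefficients vanish first, and induction handles the rest.\<close>

lemma lowered_indep: "formal_indep lowered (lowered_index p)"
proof (induction p)
  case 0
  then show ?case by (auto simp: formal_indep_def lowered_index_def)
next
  case (Suc p)
  let ?A = "{k\<in>A. p \<le> w k}"
  show ?case unfolding formal_indep_iff_has_fsum
  proof (intro allI impI)
    fix c assume c: "has_fsum (\<lambda>x m. c x * lowered x m) (lowered_index (Suc p)) (\<lambda>_. 0)"
    have "has_fsum (\<lambda>x. (X ^^ p) (\<lambda>m. c x * lowered x m)) (lowered_index (Suc p)) (\<lambda>_. 0)"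
      using row_finite_has_fsum[OF row_finite_Xop_funpow c, of p]
      by (simp add: row_finite_zero[OF row_finite_Xop_funpow])
    then have "has_fsum (\<lambda>x. (X ^^ p) (\<lambda>m. c x * lowered x m)) ((\<lambda>k. (k, p)) ` ?A) (\<lambda>_. 0)"
    proof (rule has_fsum_subset)
      fix x assume x: "x \<in> lowered_index (Suc p) - (\<lambda>k. (k, p)) ` ?A"
      then obtain k s where "x = (k, s)" "k \<in> A" "s < p"
        by (auto simp: lowered_index_def less_Suc_eq)
      then have "(X ^^ p) (lowered x) = (\<lambda>_. 0)"
        using Xop_funpow_Yop_funpow_zero[OF g_kernel g_weighted] by (simp add: lowered_def)
      then show "(X ^^ p) (\<lambda>m. c x * lowered x m) = (\<lambda>_. 0)"
        by (simp add: row_finite_scale[OF row_finite_Xop_funpow])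
    qed (auto simp: lowered_index_Suc)
    then have top: "has_fsum (\<lambda>k. (X ^^ p) (\<lambda>m. c (k, p) * lowered (k, p) m)) ?A (\<lambda>_. 0)"
      by (subst (asm) has_fsum_reindex) (auto simp: inj_on_def)
    define a where "a = (\<lambda>k. lowering_coeff (real (w k)) p)"
    have a: "\<And>k. k \<in> A \<Longrightarrow> p \<le> w k \<Longrightarrow> a k \<noteq> 0"
      "\<And>k. k \<in> A \<Longrightarrow> (X ^^ p) ((Y ^^ p) (g k)) = (\<lambda>m. a k * g k m)"
      by (simp_all add: a_def lowering_coeff_nonzero Xop_funpow_Yop_funpow_same[OF g_kernel g_weighted])
    \<comment> \<open>The extension by 0 makes the relation one over all of \<open>A\<close>, where
      \<open>g_indep\<close> is stated.\<close>
    define b where "b = (\<lambda>k. if p \<le> w k then c (k, p) * a k else 0)"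
    have "has_fsum (\<lambda>k m. b k * g k m) ?A (\<lambda>_. 0)"
      by (rule has_fsum_cong[OF top])
         (simp add: row_finite_scale[OF row_finite_Xop_funpow] lowered_def a b_def mult.assoc)
    then have "has_fsum (\<lambda>k m. b k * g k m) A (\<lambda>_. 0)"
      by (rule has_fsum_superset) (auto simp: b_def)
    then have "\<forall>k\<in>A. b k = 0" using g_indep unfolding formal_indep_iff_has_fsum by blast
    then have cp: "c (k, p) = 0" if "k \<in> ?A" for k using that a(1) by (force simp: b_def)
    have "has_fsum (\<lambda>x m. c x * lowered x m) (lowered_index p) (\<lambda>_. 0)"
      by (rule has_fsum_subset[OF c]) (use cp in \<open>auto simp: lowered_index_Suc\<close>)
    then have "\<forall>x\<in>lowered_index p. c x = 0" using Suc unfolding formal_indep_iff_has_fsum by blast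
    then show "\<forall>x\<in>lowered_index (Suc p). c x = 0" using cp by (auto simp: lowered_index_Suc)
  qed
qed

section \<open>From bottom components back to vector fields\<close>

context
  assumes blocks_pos: "\<And>j. j < length ns \<Longrightarrow> 0 < ns ! j"
begin

definition transv :: "'k \<times> nat \<times> nat \<Rightarrow> vfield" where
  "transv = (\<lambda>(k, j, s). transvectant ns (g k) (w k) (bvec ns j) (ns ! j - 1) s)"

definition transv_index :: "('k \<times> nat \<times> nat) set" where
  "transv_index = {(k, j, s). k \<in> A \<and> j < length ns \<and> s \<le> w k \<and> s \<le> ns ! j - 1}"

definition bottom_coeff :: "'k \<times> nat \<times> nat \<Rightarrow> real" where
  "bottom_coeff = (\<lambda>(k, j, s). transv_coeff (w k) (ns ! j - 1) s 0)"

lemma bottom_coeff_nonzero: "bottom_coeff x \<noteq> 0"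
  by (cases x) (simp add: bottom_coeff_def transv_coeff_nonzero)

lemma transv_in_Eset: "x \<in> transv_index \<Longrightarrow> transv x \<in> Eset ns"
  using transvectant_in_Eset g_supported g_kernel g_weighted blocks_pos
  by (auto simp: transv_index_def transv_def)

lemma transv_bottom:
  assumes "(k, j, s) \<in> transv_index" "l < length ns"
  shows "transv (k, j, s) (bottom_row ns l)
    = (if l = j then (\<lambda>m. bottom_coeff (k, j, s) * lowered (k, s) m) else (\<lambda>_. 0))"
  using transvectant_bottom[of j s "w k" l "g k"] assms blocks_pos
  by (simp add: transv_index_def transv_def bottom_coeff_def lowered_def)

lemma transv_index_iff:
  "(k, j, s) \<in> transv_index \<longleftrightarrow> j < length ns \<and> (k, s) \<in> lowered_index (ns ! j)"
proof (cases "j < length ns")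
  case True
  have "s \<le> ns ! j - 1 \<longleftrightarrow> s < ns ! j" using blocks_pos[OF True] by linarith
  then show ?thesis unfolding transv_index_def lowered_index_def by blast
qed (simp add: transv_index_def)

lemma transv_index_block:
  assumes "j < length ns"
  shows "{x\<in>transv_index. fst (snd x) = j} = (\<lambda>(k, s). (k, j, s)) ` lowered_index (ns ! j)"
  using assms by (force simp: transv_index_iff image_iff)

lemma inj_on_insert_block: "inj_on (\<lambda>(k, s). (k, j, s)) S"
  by (auto simp: inj_on_def)

text \<open>A relation between vector fields can thus be restricted to any single component.\<close>

lemma row_finite_component: "row_finite (\<lambda>F m. F (r, m))"
  unfolding row_finite_def by (auto intro: exI[of _ "{_}"])

text \<open>Only transvectants with the bottom vector of block \<open>j\<close> reach the bottom row
  of that block, and there they are multiples of lowered invariants.\<close>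

lemma has_fsum_transv_bottom:
  assumes j: "j < length ns"
  shows "has_fsum (\<lambda>x m. c x * transv x (bottom_row ns j) m) transv_index f \<longleftrightarrow>
    has_fsum (\<lambda>(k, s) m. (c (k, j, s) * bottom_coeff (k, j, s)) * lowered (k, s) m) (lowered_index (ns ! j)) f"
    (is "?L \<longleftrightarrow> ?R")
proof -
  let ?J = "{x\<in>transv_index. fst (snd x) = j}" and ?h = "\<lambda>x m. c x * transv x (bottom_row ns j) m"
  have "?h x = (\<lambda>_. 0)" if "x \<in> transv_index - ?J" for x
    using that transv_bottom[OF _ j] by (cases x) auto
  then have "?L \<longleftrightarrow> has_fsum ?h ?J f"
    using has_fsum_subset[of ?h transv_index f ?J] has_fsum_superset[of ?h ?J f transv_index] by blast
  also have "\<dots> \<longleftrightarrow> has_fsum (\<lambda>y. ?h ((\<lambda>(k, s). (k, j, s)) y)) (lowered_index (ns ! j)) f"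
    unfolding transv_index_block[OF j] by (rule has_fsum_reindex[OF inj_on_insert_block])
  also have "\<dots> \<longleftrightarrow> ?R"
  proof -
    have eq: "?h ((\<lambda>(k, s). (k, j, s)) y)
        = (\<lambda>(k, s) m. (c (k, j, s) * bottom_coeff (k, j, s)) * lowered (k, s) m) y"
      if y: "y \<in> lowered_index (ns ! j)" for y
    proof -
      obtain k s where "y = (k, s)" by (cases y)
      moreover from this have "(k, j, s) \<in> transv_index" using y j by (simp add: transv_index_iff)
      ultimately show ?thesis by (simp add: transv_bottom[OF _ j] mult.assoc)
    qed
    show ?thesis
      using eq by (auto elim!: has_fsum_cong)
  qed
  finally show ?thesis .
qed

text \<open>The bottom row of each block gives a relation among the lowered invariants, with
  coefficients rescaled by the nonzero \<open>bottom_coeff\<close>.\<close>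

lemma transv_indep: "formal_indep (\<lambda>x. vf_coeffs (transv x)) transv_index"
  unfolding formal_indep_iff_has_fsum
proof (intro allI impI ballI)
  fix c x assume c: "has_fsum (\<lambda>x m. c x * vf_coeffs (transv x) m) transv_index (\<lambda>_. 0)"
    and x: "x \<in> transv_index"
  obtain k j s where kjs: "x = (k, j, s)" by (cases x)
  have j: "j < length ns" using x kjs by (simp add: transv_index_def)
  have "has_fsum (\<lambda>x m. c x * transv x (bottom_row ns j) m) transv_index (\<lambda>_. 0)"
    using row_finite_has_fsum[OF row_finite_component c, of "bottom_row ns j"]
    by (simp add: vf_coeffs_def)
  then have "has_fsum (\<lambda>y m. (\<lambda>(k, s). c (k, j, s) * bottom_coeff (k, j, s)) y * lowered y m)
      (lowered_index (ns ! j)) (\<lambda>_. 0)"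
    unfolding has_fsum_transv_bottom[OF j] by (simp add: case_prod_beta')
  moreover have "(k, s) \<in> lowered_index (ns ! j)"
    using x by (simp add: kjs transv_index_iff)
  ultimately have "(\<lambda>(k, s). c (k, j, s) * bottom_coeff (k, j, s)) (k, s) = 0"
    by (rule formal_indepD[OF lowered_indep])
  then show "c x = 0" using bottom_coeff_nonzero by (simp add: kjs)
qed

text \<open>The expansions of the bottom components fix the coefficients. The other rows follow
  without further choice, since in \<open>v\<close> and in every transvectant they are the same
  powers of \<open>X\<close> of the bottom row.\<close>

lemma transv_span:
  assumes v: "v \<in> Eset ns"
  shows "formal_comb (\<lambda>x. vf_coeffs (transv x)) transv_index (vf_coeffs v)"
proof -
  have supp: "supp_vf (dimn ns) v" using v by (simp add: Eset_def)
  have "\<exists>d. has_fsum (\<lambda>x m. d x * lowered x m) (lowered_index (ns ! j)) (v (bottom_row ns j))"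
    if "j < length ns" for j
    using lowered_span[of "v (bottom_row ns j)" "ns ! j"] Eset_bottom_kernel[OF v that blocks_pos[OF that]] supp
    by (simp add: formal_comb_iff_has_fsum supp_vf_def)
  then obtain d where d: "\<And>j. j < length ns \<Longrightarrow>
      has_fsum (\<lambda>x m. d j x * lowered x m) (lowered_index (ns ! j)) (v (bottom_row ns j))"
    by metis
  define c where "c = (\<lambda>(k, j, s). d j (k, s) / bottom_coeff (k, j, s))"
  have bottom: "has_fsum (\<lambda>x m. c x * transv x (bottom_row ns j) m) transv_index (v (bottom_row ns j))"
    if j: "j < length ns" for j
    unfolding has_fsum_transv_bottom[OF j]
    by (rule has_fsum_cong[OF d[OF j]]) (auto simp: c_def bottom_coeff_nonzero)
  have row: "has_fsum (\<lambda>x m. c x * transv x r m) transv_index (v r)" for r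
  proof (cases "loc ns r")
    case None
    then have r: "dimn ns \<le> r" by (simp add: loc_eq_None_iff)
    have "v r = (\<lambda>_. 0)" using supp r by (simp add: supp_vf_def)
    moreover have "transv x r = (\<lambda>_. 0)" if "x \<in> transv_index" for x
      using transv_in_Eset[OF that] r by (simp add: Eset_def supp_vf_def)
    then have "{x \<in> transv_index. c x * transv x r m \<noteq> 0} = {}" for m by auto
    ultimately show ?thesis by (simp only: has_fsum_pointwise) simp
  next
    case (Some p)
    obtain j i k where "p = (j, i, k)" by (cases p)
    then have r: "loc ns r = Some (j, i, k)" using Some by simp
    then have j: "j < length ns" by (simp add: loc_eq_Some_iff)
    have "has_fsum (\<lambda>x. (X ^^ (k - 1 - i)) (\<lambda>m. c x * transv x (bottom_row ns j) m)) transv_index (v r)"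
      unfolding Eset_component[OF v r] by (rule row_finite_has_fsum[OF row_finite_Xop_funpow bottom[OF j]])
    then show ?thesis
    proof (rule has_fsum_cong)
      fix x assume "x \<in> transv_index"
      then show "(X ^^ (k - 1 - i)) (\<lambda>m. c x * transv x (bottom_row ns j) m) = (\<lambda>m. c x * transv x r m)"
        unfolding row_finite_scale[OF row_finite_Xop_funpow]
        using Eset_component[OF transv_in_Eset r] by metis
    qed
  qed
  have "has_fsum (\<lambda>x m. c x * vf_coeffs (transv x) m) transv_index (vf_coeffs v)"
    using row unfolding has_fsum_pointwise by (auto simp: vf_coeffs_def)
  then show ?thesis unfolding formal_comb_iff_has_fsum by blast
qed

end

end

section \<open>Monomials in the generators\<close>

lemma supp_fps_one: "supp_fps n fps_one"
  by (simp add: supp_fps_def fps_one_def)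

lemma DA_fps_one: "DA n A fps_one = (\<lambda>_. 0)"
proof -
  have "mulx j (pderiv_n i fps_one) m = 0" for i j m
    by (auto simp: mulx_pderiv_n fps_one_def split: if_splits)
  then show ?thesis by (simp add: DA_def)
qed

lemma fps_mult_zero_left: "fps_mult (\<lambda>_. 0) f = (\<lambda>_. 0)"
  and fps_mult_zero_right: "fps_mult f (\<lambda>_. 0) = (\<lambda>_. 0)"
  by (simp_all add: fps_mult_def)

text \<open>Weights are natural numbers here because transvectants use their factorials.\<close>

definition weight_invariant :: "nat \<Rightarrow> fps_n \<Rightarrow> bool" where
  "weight_invariant c f \<longleftrightarrow> supported f \<and> X f = (\<lambda>_. 0) \<and> weighted (real c) f"

lemma weight_invariant_one: "weight_invariant 0 fps_one"
proof -
  have "weighted 0 fps_one" by (auto simp: has_weight_def fps_one_def mweight_def)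
  then show ?thesis
    by (simp add: weight_invariant_def supp_fps_one Xop_def DA_fps_one)
qed

text \<open>\<open>X\<close> is a derivation and weights add under multiplication, so the properties
  pass from the generators to their monomials.\<close>

lemma weight_invariant_mult:
  assumes "weight_invariant c f" "weight_invariant d g"
  shows "weight_invariant (c + d) (fps_mult f g)"
  using assms has_weight_fps_mult[of "dimn ns" "triad_weight ns" c f d g]
  by (simp add: weight_invariant_def supp_fps_mult Xop_def DA_fps_mult fps_mult_zero_left fps_mult_zero_right)

lemma weight_invariant_pow:
  assumes "weight_invariant c f"
  shows "weight_invariant (c * e) (fps_pow f e)"
proof (induction e)
  case 0
  show ?case by (simp add: fps_pow_def weight_invariant_one)
next
  case (Suc e)
  then show ?case using weight_invariant_mult[OF assms Suc] by (simp add: fps_pow_def)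
qed

lemma weight_invariant_monom:
  assumes "length wts = length \<alpha>" "length \<alpha> = length k"
    and "\<And>i. i < length \<alpha> \<Longrightarrow> weight_invariant (wts ! i) (\<alpha> ! i)"
  shows "weight_invariant (wt wts k) (fps_monom \<alpha> k)"
  using assms
proof (induction wts \<alpha> k rule: list_induct3)
  case Nil
  show ?case by (simp add: wt_def fps_monom_def weight_invariant_one)
next
  case (Cons u us f fs e es)
  have "weight_invariant (us ! i) (fs ! i)" if "i < length fs" for i
    using Cons.prems[of "Suc i"] that by simp
  then have "weight_invariant (wt us es) (fps_monom fs es)" by (rule Cons.IH)
  moreover have "weight_invariant u f" using Cons.prems[of 0] by simp
  ultimately show ?case
    using weight_invariant_mult[OF weight_invariant_pow] by (simp add: wt_def fps_monom_def)
qed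

lemma weighted_iff_Zop: "Zop ns f = (\<lambda>m. c * f m) \<longleftrightarrow> weighted c f"
  by (auto simp: Zop_eq has_weight_def fun_eq_iff)

end

theorem theorem17p5:
  fixes ns :: "nat list" and \<alpha> :: "fps_n list" and wts :: "nat list" and A :: "nat list set"
  assumes blocks_pos: "\<forall>k\<in>set ns. 0 < k"
    and len_wts: "length wts = length \<alpha>"
    and alpha_inv: "\<forall>i<length \<alpha>. \<alpha> ! i \<in> Jset ns"
    and alpha_homog: "\<forall>i<length \<alpha>. fps_homogeneous (dimn ns) (\<alpha> ! i)"
    and alpha_weight: "\<forall>i<length \<alpha>. Zop ns (\<alpha> ! i) = (\<lambda>m. real (wts ! i) * (\<alpha> ! i) m)"
    and hilbert_span: "\<forall>f\<in>Jset ns. formal_comb (fps_monom \<alpha>) {k. length k = length \<alpha>} f"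
    and A_sub: "A \<subseteq> {k. length k = length \<alpha>}"
    and A_distinct: "inj_on (fps_monom \<alpha>) A"
    and A_indep: "formal_indep (fps_monom \<alpha>) A"
    and A_span: "\<forall>f\<in>Jset ns. formal_comb (fps_monom \<alpha>) A f"
    and A_closed: "\<forall>k\<in>A. \<forall>k'. length k' = length \<alpha> \<and> (\<forall>i<length \<alpha>. k' ! i \<le> k ! i) \<longrightarrow> k' \<in> A"
  defines "I \<equiv> {(k, j, s). k \<in> A \<and> j < length ns \<and> s \<le> wt wts k \<and> s \<le> ns ! j - 1}"
    and "T \<equiv> (\<lambda>(k, j, s). transvectant ns (fps_monom \<alpha> k) (wt wts k) (bvec ns j) (ns ! j - 1) s)"
  shows "(\<forall>x\<in>I. T x \<in> Eset ns)
       \<and> formal_indep (\<lambda>x. vf_coeffs (T x)) I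
       \<and> (\<forall>v\<in>Eset ns. formal_comb (\<lambda>x. vf_coeffs (T x)) I (vf_coeffs v))"
proof -
  have "weight_invariant ns (wts ! i) (\<alpha> ! i)" if "i < length \<alpha>" for i
    using alpha_inv alpha_weight that
    by (auto simp: weight_invariant_def Jset_def weighted_iff_Zop[symmetric])
  then have inv: "weight_invariant ns (wt wts k) (fps_monom \<alpha> k)" if "k \<in> A" for k
    using weight_invariant_monom[OF len_wts, of k ns] A_sub that by auto
  have supp: "\<And>k. k \<in> A \<Longrightarrow> supp_fps (dimn ns) (fps_monom \<alpha> k)"
    and ker: "\<And>k. k \<in> A \<Longrightarrow> Xop ns (fps_monom \<alpha> k) = (\<lambda>_. 0)"
    and weight: "\<And>k. k \<in> A \<Longrightarrow>
      has_weight (dimn ns) (triad_weight ns) (real (wt wts k)) (fps_monom \<alpha> k)"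
    using inv by (auto simp: weight_invariant_def)
  have span: "\<And>f. supp_fps (dimn ns) f \<Longrightarrow> Xop ns f = (\<lambda>_. 0) \<Longrightarrow> formal_comb (fps_monom \<alpha>) A f"
    using A_span by (simp add: Jset_def)
  have pos: "\<And>j. j < length ns \<Longrightarrow> 0 < ns ! j" using blocks_pos by simp
  note hyps = supp ker weight A_indep span pos
  \<comment> \<open>The abstract basis of weight vectors is specialised to the monomials indexed by
    \<open>A\<close>.\<close>
  have T: "T = transv ns (fps_monom \<alpha>) (wt wts)" and I: "I = transv_index ns A (wt wts)"
    by (simp_all add: T_def I_def transv_def[OF hyps] transv_index_def[OF hyps])
  show ?thesis
    unfolding T I using transv_in_Eset[OF hyps] transv_indep[OF hyps] transv_span[OF hyps] by blast
qed

end
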